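(* Let $\mathcal{H}\subset L^2_\pi$ be a reproducing kernel Hilbert space on a domain $\Omega$ with base measure $\pi$ and positive semidefinite kernel $K$. Assume that the eigenvalues of the integral operator $\mathcal{T}_\pi$ decay as $t_i\asymp i^{-\kappa}$ with parameter $\kappa\in\mathbb{R}_{>0}$. Let $\mathcal{F}=\{f : \|f\|_{\mathcal{H}}\le 1\}$, let $\lambda\in\mathbb{R}_{>0}$ and $r>0$ be fixed, and let $$\mathcal{G}=\Big\{\nu \ :\ \big\|\mathcal{T}_\pi^{-(\lambda-1)/2}\tfrac{d\nu}{d\pi}\big\|_{\mathcal{H}}\le r\Big\}$$ be the class of target probability distributions $\nu$ whose Radon–Nikodym derivative $\frac{d\nu}{d\pi}$ satisfies this bound. Assume that there is a constant $C$ with $$\sup_{\nu\in\mathcal{G}}\ \sup_{i\in\mathbb{N}_{\ge0}}\ \mathbb{E}_{X\sim\nu}\,\psi_i(X)^2\le C ,$$ where $\psi_i$ are the eigenfunctions of $\mathcal{T}_\pi$. Then there exists an estimator $\widetilde\nu_n$ based on $n$ i.i.d. samples from $\nu$ such that $$\sup_{\nu\in\mathcal{G}}\ \mathbb{E}\, d_{\mathcal{F}}(\nu,\widetilde{\nu}_n)\ \precsim\ n^{-\frac{(\lambda+1)\kappa}{2\lambda\kappa+2}}\vee n^{-\frac12}.$$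
   Context: The integral operator $\mathcal{T}_\pi:L^2_\pi\to\mathcal{H}$ is $\mathcal{T}_\pi f(z)=\int_\Omega K(z,\cdot)f(\cdot)\,d\pi(\cdot)$. By Mercer's theorem it has eigenfunctions $\psi_i$ and eigenvalues $t_i$, $i\in\mathbb{N}_{\ge0}$, sorted in non-increasing order, with $\mathcal{T}_\pi\psi_i=t_i\psi_i$ and $\int_\Omega\psi_i\psi_j\,d\pi=\delta_{ij}$. In this basis, for $f=\sum_i f_i\psi_i$ with $f_i=\int f\psi_i\,d\pi$, one has $\|f\|_{\mathcal{H}}^2=\sum_i t_i^{-1}f_i^2$, and powers of $\mathcal{T}_\pi$ act by $\mathcal{T}_\pi^{s}f=\sum_i t_i^{s}f_i\psi_i$; thus, writing $\frac{d\nu}{d\pi}=\sum_i\nu_i\psi_i$, the condition defining $\mathcal{G}$ is $\sum_i t_i^{-\lambda}\nu_i^2\le r^2$. For a symmetric class $\mathcal{F}$, $d_{\mathcal{F}}(\mu,\nu)=\sup_{f\in\mathcal{F}}\int_\Omega f\,(d\mu-d\nu)$; the same formula is used when an argument is a finite signed measure. An estimator is a (measurable) function of the sample with values in finite (possibly signed) measures on $\Omega$. The expectation is over the i.i.d. samples. Notation: $a\vee b=\max(a,b)$. Holding other parameters fixed, $A(n)\precsim n^{s}$ means $\limsup_{n\to\infty}\log A(n)/\log n\le s$; $A(n)\succsim n^{s}$ means $\liminf_{n\to\infty}\log A(n)/\log n\ge s$; $A(n)\asymp n^{s}$ means both (used for $t_i$ as a sequence in $i\to\infty$). *)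

theory Defs
  imports "HOL-Probability.Probability"
begin

text \<open>
  Logarithmic orders of growth. Values are extended non-negative reals, since a minimax risk may be
  infinite; the logarithm of \<open>0\<close> is \<open>-\<infinity>\<close> (Isabelle's \<open>ln 0 = 0\<close> would be wrong here).
\<close>

definition ennln :: "ennreal \<Rightarrow> ereal" where
  "ennln x = (if x = 0 then - \<infinity> else if x = \<infinity> then \<infinity> else ereal (ln (enn2real x)))"

definition precsim_pow :: "(nat \<Rightarrow> ennreal) \<Rightarrow> real \<Rightarrow> bool" where
  "precsim_pow A s \<longleftrightarrow> limsup (\<lambda>n. ennln (A n) / ereal (ln (real n))) \<le> ereal s"

definition succsim_pow :: "(nat \<Rightarrow> ennreal) \<Rightarrow> real \<Rightarrow> bool" where
  "succsim_pow A s \<longleftrightarrow> ereal s \<le> liminf (\<lambda>n. ennln (A n) / ereal (ln (real n)))"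

definition asymp_pow :: "(nat \<Rightarrow> ennreal) \<Rightarrow> real \<Rightarrow> bool" where
  "asymp_pow A s \<longleftrightarrow> precsim_pow A s \<and> succsim_pow A s"


definition square_integrable :: "'a measure \<Rightarrow> ('a \<Rightarrow> real) \<Rightarrow> bool" where
  "square_integrable M f \<longleftrightarrow> f \<in> borel_measurable M \<and> integrable M (\<lambda>x. (f x)\<^sup>2)"

definition L2_coeff :: "'a measure \<Rightarrow> (nat \<Rightarrow> 'a \<Rightarrow> real) \<Rightarrow> ('a \<Rightarrow> real) \<Rightarrow> nat \<Rightarrow> real" where
  "L2_coeff M \<psi> f i = (\<integral>x. f x * \<psi> i x \<partial>M)"

text \<open>\<open>f = (\<Sum>i. c i * \<psi> i)\<close> with convergence in the space of square integrable functions.\<close>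

definition L2_sums ::
  "'a measure \<Rightarrow> (nat \<Rightarrow> 'a \<Rightarrow> real) \<Rightarrow> (nat \<Rightarrow> real) \<Rightarrow> ('a \<Rightarrow> real) \<Rightarrow> bool" where
  "L2_sums M \<psi> c f \<longleftrightarrow> square_integrable M f \<and>
     (\<lambda>N. \<integral>x. (f x - (\<Sum>i<N. c i * \<psi> i x))\<^sup>2 \<partial>M) \<longlonglongrightarrow> 0"


definition psd_kernel :: "'a set \<Rightarrow> ('a \<Rightarrow> 'a \<Rightarrow> real) \<Rightarrow> bool" where
  "psd_kernel \<Omega> K \<longleftrightarrow> (\<forall>x\<in>\<Omega>. \<forall>y\<in>\<Omega>. K x y = K y x) \<and>
     (\<forall>X c. finite X \<longrightarrow> X \<subseteq> \<Omega> \<longrightarrow> 0 \<le> (\<Sum>x\<in>X. \<Sum>y\<in>X. c x * c y * K x y))"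

text \<open>
  The Hilbert space is the type \<open>'h\<close>; \<open>fn h\<close> is the function on \<open>\<Omega>\<close> that \<open>h\<close> stands for. The
  first three conditions say that \<open>fn\<close> identifies \<open>'h\<close> with a linear space of functions on \<open>\<Omega>\<close>
  (values outside \<open>\<Omega>\<close> are irrelevant), the last one is the reproducing property.
\<close>

definition rkhs ::
  "'a set \<Rightarrow> ('a \<Rightarrow> 'a \<Rightarrow> real) \<Rightarrow> ('h::{real_inner, complete_space} \<Rightarrow> 'a \<Rightarrow> real) \<Rightarrow> bool" where
  "rkhs \<Omega> K fn \<longleftrightarrow>
     (\<forall>f g. \<forall>x\<in>\<Omega>. fn (f + g) x = fn f x + fn g x) \<and>
     (\<forall>c f. \<forall>x\<in>\<Omega>. fn (c *\<^sub>R f) x = c * fn f x) \<and>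
     (\<forall>f. (\<forall>x\<in>\<Omega>. fn f x = 0) \<longrightarrow> f = 0) \<and>
     (\<forall>x\<in>\<Omega>. \<exists>k. (\<forall>y\<in>\<Omega>. fn k y = K x y) \<and> (\<forall>f. fn f x = f \<bullet> k))"

definition rkhs_ball :: "('h::real_normed_vector \<Rightarrow> 'a \<Rightarrow> real) \<Rightarrow> ('a \<Rightarrow> real) set" where
  "rkhs_ball fn = {fn h |h. norm h \<le> 1}"

definition integral_op ::
  "'a measure \<Rightarrow> ('a \<Rightarrow> 'a \<Rightarrow> real) \<Rightarrow> ('a \<Rightarrow> real) \<Rightarrow> 'a \<Rightarrow> real" where
  "integral_op M K f z = (\<integral>y. K z y * f y \<partial>M)"

text \<open>
  The eigensystem provided by Mercer's theorem. The last condition says that no eigenfunction with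
  non-zero eigenvalue is missing; the operator may have a non-trivial null space.
\<close>

definition mercer_system ::
  "'a measure \<Rightarrow> ('a \<Rightarrow> 'a \<Rightarrow> real) \<Rightarrow> (nat \<Rightarrow> real) \<Rightarrow> (nat \<Rightarrow> 'a \<Rightarrow> real) \<Rightarrow> bool" where
  "mercer_system M K t \<psi> \<longleftrightarrow>
     (\<forall>i. square_integrable M (\<psi> i)) \<and>
     (\<forall>i j. (\<integral>x. \<psi> i x * \<psi> j x \<partial>M) = (if i = j then 1 else 0)) \<and>
     (\<forall>i. AE z in M. integral_op M K (\<psi> i) z = t i * \<psi> i z) \<and>
     antimono t \<and>
     (\<forall>f. square_integrable M f \<longrightarrow>
        L2_sums M \<psi> (\<lambda>i. t i * L2_coeff M \<psi> f i) (integral_op M K f))"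

text \<open>
  \<open>g\<close> is (a representative of) the \<open>s\<close>-th power of the integral operator applied to
  \<open>f = (\<Sum>i. f\<^sub>i * \<psi> i)\<close>, namely \<open>(\<Sum>i. t i powr s * f\<^sub>i * \<psi> i)\<close>.
\<close>

definition is_op_power ::
  "'a measure \<Rightarrow> (nat \<Rightarrow> real) \<Rightarrow> (nat \<Rightarrow> 'a \<Rightarrow> real) \<Rightarrow> real \<Rightarrow> ('a \<Rightarrow> real) \<Rightarrow> ('a \<Rightarrow> real) \<Rightarrow> bool" where
  "is_op_power M t \<psi> s f g \<longleftrightarrow>
     L2_sums M \<psi> (L2_coeff M \<psi> f) f \<and>
     L2_sums M \<psi> (\<lambda>i. t i powr s * L2_coeff M \<psi> f i) g"

text \<open>
  The Hilbert space norm of a function known up to null sets is at most \<open>r\<close> if some \<open>h\<close> of norm at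
  most \<open>r\<close> represents it.
\<close>

definition target_class ::
  "'a measure \<Rightarrow> ('h::{real_inner, complete_space} \<Rightarrow> 'a \<Rightarrow> real) \<Rightarrow>
   (nat \<Rightarrow> real) \<Rightarrow> (nat \<Rightarrow> 'a \<Rightarrow> real) \<Rightarrow> real \<Rightarrow> real \<Rightarrow> 'a measure set" where
  "target_class M fn t \<psi> l r =
     {\<nu>. prob_space \<nu> \<and> sets \<nu> = sets M \<and> absolutely_continuous M \<nu> \<and>
          (\<exists>h. is_op_power M t \<psi> (- (l - 1) / 2) (\<lambda>x. enn2real (RN_deriv M \<nu> x)) (fn h) \<and>
               norm h \<le> r)}"


definition finite_signed_measure :: "'a measure \<Rightarrow> ('a set \<Rightarrow> real) \<Rightarrow> bool" where
  "finite_signed_measure M \<sigma> \<longleftrightarrow> \<sigma> {} = 0 \<and>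
     (\<forall>A::nat \<Rightarrow> 'a set. range A \<subseteq> sets M \<longrightarrow> disjoint_family A \<longrightarrow>
        (\<lambda>i. \<sigma> (A i)) sums \<sigma> (\<Union>i. A i))"

text \<open>The positive part of the Jordan decomposition; the negative part is that of \<open>- \<sigma>\<close>.\<close>

definition upper_variation :: "'a measure \<Rightarrow> ('a set \<Rightarrow> real) \<Rightarrow> 'a measure" where
  "upper_variation M \<sigma> =
     measure_of (space M) (sets M) (\<lambda>A. SUP B\<in>{B \<in> sets M. B \<subseteq> A}. ennreal (\<sigma> B))"

definition signed_integrable :: "'a measure \<Rightarrow> ('a set \<Rightarrow> real) \<Rightarrow> ('a \<Rightarrow> real) \<Rightarrow> bool" where
  "signed_integrable M \<sigma> f \<longleftrightarrow>
     integrable (upper_variation M \<sigma>) f \<and> integrable (upper_variation M (\<lambda>A. - \<sigma> A)) f"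

definition signed_integral :: "'a measure \<Rightarrow> ('a set \<Rightarrow> real) \<Rightarrow> ('a \<Rightarrow> real) \<Rightarrow> real" where
  "signed_integral M \<sigma> f =
     (\<integral>x. f x \<partial>upper_variation M \<sigma>) - (\<integral>x. f x \<partial>upper_variation M (\<lambda>A. - \<sigma> A))"

text \<open>
  A test function that is not integrable contributes \<open>\<infinity>\<close>, so that the default value \<open>0\<close> of an
  undefined integral cannot make the distance small.
\<close>

definition ipm ::
  "'a measure \<Rightarrow> ('a \<Rightarrow> real) set \<Rightarrow> ('a set \<Rightarrow> real) \<Rightarrow> ('a set \<Rightarrow> real) \<Rightarrow> ereal" where
  "ipm M F \<mu> \<nu> =
     (SUP f\<in>F. if signed_integrable M (\<lambda>A. \<mu> A - \<nu> A) f
               then ereal (signed_integral M (\<lambda>A. \<mu> A - \<nu> A) f) else \<infinity>)"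

definition signed_estimator ::
  "'a measure \<Rightarrow> nat \<Rightarrow> ((nat \<Rightarrow> 'a) \<Rightarrow> 'a set \<Rightarrow> real) \<Rightarrow> bool" where
  "signed_estimator M n T \<longleftrightarrow>
     (\<forall>x \<in> space (Pi\<^sub>M {..<n} (\<lambda>_. M)). finite_signed_measure M (T x)) \<and>
     (\<forall>A \<in> sets M. (\<lambda>x. T x A) \<in> borel_measurable (Pi\<^sub>M {..<n} (\<lambda>_. M)))"

text \<open>
  The truncation \<open>e2ennreal\<close> is harmless: \<open>ipm\<close> is non-negative for a class containing \<open>0\<close>.
\<close>

definition expected_loss ::
  "'a measure \<Rightarrow> ('a \<Rightarrow> real) set \<Rightarrow> nat \<Rightarrow> ((nat \<Rightarrow> 'a) \<Rightarrow> 'a set \<Rightarrow> real) \<Rightarrow> 'a measure \<Rightarrow> ennreal" where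
  "expected_loss M F n T \<nu> =
     (\<integral>\<^sup>+x. e2ennreal (ipm M F (measure \<nu>) (T x)) \<partial>(Pi\<^sub>M {..<n} (\<lambda>_. \<nu>)))"

end

theory Submission
  imports Defs
begin

text \<open>
  Write \<open>q\<close> for the density of \<open>\<nu>\<close> and \<open>\<nu>\<^sub>i = \<integral> \<psi>\<^sub>i d\<nu>\<close> for its coefficients. The estimator is a
  truncated orthogonal series: for \<open>i < m\<close> it replaces \<open>\<nu>\<^sub>i\<close> by the sample mean \<open>c\<^sub>i\<close> of \<open>\<psi>\<^sub>i\<close>, and it
  drops all other coefficients.

  The distance over the unit ball of the Hilbert space is a Hilbert space norm. The space embeds
  boundedly into the square integrable functions, so the embedding has an adjoint \<open>adj\<close>, and
  \<open>\<integral> h g d\<pi> = adj g \<bullet> h\<close>. Hence the distance between two measures whose densities differ by \<open>g\<close> is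
  \<open>norm (adj g)\<close> (lemma \<open>ipm_rkhs_ball\<close>). Since embedding after \<open>adj\<close> is the integral operator, the
  Mercer expansion gives \<open>(norm (adj g))\<^sup>2 = (\<Sum>i. t\<^sub>i g\<^sub>i\<^sup>2)\<close> (lemma \<open>norm_adj_sums\<close>). The squared error of
  the series estimator is therefore the sum of a stochastic part \<open>(\<Sum>i<m. t\<^sub>i (c\<^sub>i - \<nu>\<^sub>i)\<^sup>2)\<close>, of
  expectation at most \<open>(C / n) (\<Sum>i<m. t\<^sub>i)\<close>, and of a squared bias \<open>(\<Sum>i\<ge>m. t\<^sub>i \<nu>\<^sub>i\<^sup>2)\<close>. The class bounds
  \<open>(\<Sum>i. t\<^sub>i powr (- l) * \<nu>\<^sub>i\<^sup>2)\<close> by \<open>r\<^sup>2\<close>, through Bessel's inequality in the Hilbert space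
  (lemmas \<open>Bessel_rkhs\<close>, \<open>target_class_density\<close>), so the squared bias is at most
  \<open>t\<^sub>m powr (l + 1) * r\<^sup>2\<close>.

  With \<open>t\<^sub>i\<close> of order \<open>i powr (- \<kappa>)\<close> and \<open>m\<close> of order \<open>n powr (1 / (l \<kappa> + 1))\<close> the bias has the order
  \<open>n powr (- (l + 1) \<kappa> / (2 l \<kappa> + 2))\<close>. The standard deviation has the same order if \<open>\<kappa> \<le> 1\<close>; if
  \<open>\<kappa> > 1\<close> the eigenvalues are summable and it has order \<open>n powr (- 1 / 2)\<close>
  (lemma \<open>variance_bias_rate\<close>). Arbitrarily small powers of \<open>n\<close> are absorbed by the notion of order.

  One point needs extra care. The base measure is only \<open>\<sigma>\<close>-finite, so \<open>\<psi>\<^sub>i\<close> need not be integrable and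
  \<open>\<psi>\<^sub>i d\<pi>\<close> need not be a finite signed measure. The estimator therefore uses integrable functions
  \<open>\<phi>\<^sub>i\<close> that are so close to \<open>\<psi>\<^sub>i\<close> that the exchange costs at most a multiple of \<open>1 / n\<close>.
\<close>

section \<open>Representation of bounded functionals on a Hilbert space\<close>

text \<open>
  The representing vector minimises \<open>h \<bullet> h - 2 * \<phi> h\<close>. By the parallelogram law a minimising
  sequence is Cauchy, so completeness provides the minimiser.
\<close>

lemma riesz_representation:
  fixes \<phi> :: "'h::{real_inner, complete_space} \<Rightarrow> real"
  assumes "bounded_linear \<phi>"
  shows "\<exists>u. \<forall>h. u \<bullet> h = \<phi> h"
proof -
  interpret bounded_linear \<phi> by fact
  define J where "J h = h \<bullet> h - 2 * \<phi> h" for h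
  obtain B where B: "\<And>h. \<bar>\<phi> h\<bar> \<le> norm h * B"
    using bounded by auto
  have "- (B\<^sup>2) \<le> J h" for h
  proof -
    have "0 \<le> (norm h - B)\<^sup>2" by simp
    moreover have "\<phi> h \<le> norm h * B" using B[of h] by auto
    ultimately show ?thesis
      unfolding J_def dot_square_norm by (simp add: power2_diff)
  qed
  then have bdd: "bdd_below (range J)"
    by (auto intro!: bdd_belowI)
  define m where "m = Inf (range J)"
  have m_le: "m \<le> J h" for h
    unfolding m_def by (rule cInf_lower) (use bdd in auto)
  have "\<exists>h. J h < m + 1 / real (Suc k)" for k
    using cInf_lessD[of "range J" "m + 1 / real (Suc k)"] by (auto simp: m_def)
  then obtain X where X: "\<And>k. J (X k) < m + 1 / real (Suc k)" by metis
  have par: "(norm (a - b))\<^sup>2 \<le> 2 * (J a - m) + 2 * (J b - m)" for a b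
  proof -
    have "(norm (a - b))\<^sup>2 = 2 * J a + 2 * J b - 4 * J ((1/2) *\<^sub>R (a + b))"
      unfolding J_def dot_square_norm[symmetric]
      by (simp add: scaleR add inner_diff_left inner_diff_right inner_add_left inner_add_right inner_commute algebra_simps)
    with m_le[of "(1/2) *\<^sub>R (a + b)"] show ?thesis by simp
  qed
  have "Cauchy X"
  proof (rule metric_CauchyI)
    fix e :: real assume "0 < e"
    then obtain N where N: "1 / real (Suc N) < e\<^sup>2 / 4"
      using nat_approx_posE[of "e\<^sup>2 / 4"] by auto
    have small: "J (X k) - m < e\<^sup>2 / 4" if "k \<ge> N" for k
    proof -
      have "1 / real (Suc k) \<le> 1 / real (Suc N)" using that by (simp add: frac_le)
      with X[of k] N show ?thesis by linarith
    qed
    have "dist (X i) (X j) < e" if "i \<ge> N" "j \<ge> N" for i j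
    proof -
      have quarters: "d < q" if "d \<le> 2 * a + 2 * b" "a < q / 4" "b < q / 4" for a b d q :: real
        using that by simp
      have "(norm (X i - X j))\<^sup>2 < e\<^sup>2"
        by (rule quarters[OF par small[OF that(1)] small[OF that(2)]])
      then show ?thesis
        using \<open>0 < e\<close> by (simp add: dist_norm power_less_imp_less_base)
    qed
    then show "\<exists>M. \<forall>i\<ge>M. \<forall>j\<ge>M. dist (X i) (X j) < e" by blast
  qed
  then obtain u where u: "X \<longlonglongrightarrow> u"
    using Cauchy_convergent convergent_def by blast
  have J_lim: "(\<lambda>k. J (X k)) \<longlonglongrightarrow> J u"
    unfolding J_def by (intro tendsto_intros u tendsto)
  have m_lim: "(\<lambda>k. m + 1 / real (Suc k)) \<longlonglongrightarrow> m + 0"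
    by (intro tendsto_intros LIMSEQ_Suc[OF lim_1_over_n])
  have "J u \<le> m + 0"
    by (rule LIMSEQ_le[OF J_lim m_lim]) (use X in \<open>blast intro: less_imp_le\<close>)
  then have min: "J u \<le> J h" for h using m_le[of h] by simp
  have "u \<bullet> h = \<phi> h" for h
  proof (cases "h = 0")
    case True then show ?thesis by (simp add: zero)
  next
    case False
    \<comment> \<open>The quadratic \<open>s \<mapsto> J (u + s h) - J u\<close> is non-negative, in particular at its vertex.\<close>
    define d where "d = u \<bullet> h - \<phi> h"
    define s where "s = - d / (h \<bullet> h)"
    have hh: "h \<bullet> h > 0" using False by simp
    have "J (u + s *\<^sub>R h) - J u = 2 * s * d + s\<^sup>2 * (h \<bullet> h)"
      unfolding J_def d_def
      by (simp add: add scaleR inner_add_left inner_add_right inner_commute power2_eq_square algebra_simps)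
    also have "\<dots> = - d\<^sup>2 / (h \<bullet> h)"
      using hh by (simp add: s_def field_simps power2_eq_square)
    finally have "d\<^sup>2 / (h \<bullet> h) \<le> 0" using min[of "u + s *\<^sub>R h"] by simp
    then have "d\<^sup>2 \<le> 0" using hh by (simp add: divide_le_0_iff)
    then show ?thesis by (simp add: d_def)
  qed
  then show ?thesis by blast
qed

lemma Sup_inner_unit_ball:
  fixes u :: "'h::real_inner"
  shows "(SUP h\<in>{h. norm h \<le> 1}. ereal (u \<bullet> h)) = ereal (norm u)"
proof (rule antisym)
  show "(SUP h\<in>{h. norm h \<le> 1}. ereal (u \<bullet> h)) \<le> ereal (norm u)"
  proof (intro SUP_least)
    fix h :: 'h assume "h \<in> {h. norm h \<le> 1}"
    then have "norm u * norm h \<le> norm u * 1" by (intro mult_left_mono) auto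
    with norm_cauchy_schwarz[of u h] show "ereal (u \<bullet> h) \<le> ereal (norm u)" by simp
  qed
  have "u \<bullet> sgn u = norm u"
    by (cases "u = 0") (simp_all add: sgn_div_norm dot_square_norm power2_eq_square)
  moreover have "norm (sgn u) \<le> 1" by (simp add: norm_sgn)
  ultimately show "ereal (norm u) \<le> (SUP h\<in>{h. norm h \<le> 1}. ereal (u \<bullet> h))"
    by (intro SUP_upper2[where i = "sgn u"]) auto
qed

section \<open>Square integrable functions\<close>

lemma square_integrable_measurable: "square_integrable M f \<Longrightarrow> f \<in> borel_measurable M"
  by (simp add: square_integrable_def)

lemma square_integrable_mult:
  assumes "square_integrable M f" "square_integrable M g"
  shows "integrable M (\<lambda>x. f x * g x)"
proof (rule Bochner_Integration.integrable_bound)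
  show "integrable M (\<lambda>x. (f x)\<^sup>2 + (g x)\<^sup>2)"
    using assms by (simp add: square_integrable_def)
  show "(\<lambda>x. f x * g x) \<in> borel_measurable M"
    using assms by (intro borel_measurable_times) (auto simp: square_integrable_def)
  have "\<bar>a * b\<bar> \<le> a\<^sup>2 + b\<^sup>2" for a b :: real
  proof -
    have "0 \<le> (\<bar>a\<bar> - \<bar>b\<bar>)\<^sup>2" by simp
    then have "2 * (\<bar>a\<bar> * \<bar>b\<bar>) \<le> a\<^sup>2 + b\<^sup>2"
      by (simp add: power2_diff)
    moreover have "0 \<le> \<bar>a\<bar> * \<bar>b\<bar>" by simp
    ultimately show ?thesis unfolding abs_mult by linarith
  qed
  then show "AE x in M. norm (f x * g x) \<le> norm ((f x)\<^sup>2 + (g x)\<^sup>2)"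
    by (auto intro!: AE_I2)
qed

lemma square_integrable_scale:
  "square_integrable M f \<Longrightarrow> square_integrable M (\<lambda>x. c * f x)"
  by (auto simp: square_integrable_def power_mult_distrib)

lemma square_integrable_add:
  assumes "square_integrable M f" "square_integrable M g"
  shows "square_integrable M (\<lambda>x. f x + g x)"
  using assms square_integrable_mult[OF assms]
  by (auto simp: square_integrable_def power2_sum mult.assoc)

lemma square_integrable_diff:
  assumes "square_integrable M f" "square_integrable M g"
  shows "square_integrable M (\<lambda>x. f x - g x)"
  using assms square_integrable_mult[OF assms]
  by (auto simp: square_integrable_def power2_diff mult.assoc)

lemma square_integrable_sum:
  assumes "\<And>i. i \<in> I \<Longrightarrow> square_integrable M (f i)"
  shows "square_integrable M (\<lambda>x. \<Sum>i\<in>I. f i x)"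
proof (cases "finite I")
  case True
  then show ?thesis using assms
  proof (induction I)
    case empty
    show ?case by (simp add: square_integrable_def)
  next
    case (insert i I)
    then show ?case using square_integrable_add[of M "f i" "\<lambda>x. \<Sum>i\<in>I. f i x"] by simp
  qed
qed (simp add: square_integrable_def)

lemma L2_Cauchy_Schwarz:
  assumes f: "square_integrable M f" and g: "square_integrable M g"
  shows "(\<integral>x. f x * g x \<partial>M)\<^sup>2 \<le> (\<integral>x. (f x)\<^sup>2 \<partial>M) * (\<integral>x. (g x)\<^sup>2 \<partial>M)"
proof -
  define a b d where "a = (\<integral>x. (f x)\<^sup>2 \<partial>M)" and "b = (\<integral>x. f x * g x \<partial>M)" and "d = (\<integral>x. (g x)\<^sup>2 \<partial>M)"
  have quad: "0 \<le> a - 2 * s * b + s\<^sup>2 * d" for s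
  proof -
    have "0 \<le> (\<integral>x. (f x - s * g x)\<^sup>2 \<partial>M)" by simp
    also have "\<dots> = (\<integral>x. (f x)\<^sup>2 - 2 * s * (f x * g x) + s\<^sup>2 * (g x)\<^sup>2 \<partial>M)"
      by (intro Bochner_Integration.integral_cong) (auto simp: power2_diff power_mult_distrib)
    also have "\<dots> = a - 2 * s * b + s\<^sup>2 * d"
      using f g square_integrable_mult[OF f g]
      by (simp add: square_integrable_def a_def b_def d_def)
    finally show ?thesis .
  qed
  have "b\<^sup>2 \<le> a * d"
  proof (cases "d = 0")
    case True
    have "b = 0"
    proof (rule ccontr)
      assume "b \<noteq> 0"
      then show False using quad[of "(a + 1) / (2 * b)"] True by simp
    qed
    then show ?thesis using True by simp
  next
    case False
    then have d: "0 < d" by (simp add: d_def less_le)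
    have "a - 2 * (b / d) * b + (b / d)\<^sup>2 * d = a - b\<^sup>2 / d"
      using d by (simp add: field_simps power2_eq_square)
    with quad[of "b / d"] have "b\<^sup>2 / d \<le> a" by simp
    with d show ?thesis by (simp add: field_simps)
  qed
  then show ?thesis by (simp add: a_def b_def d_def)
qed

text \<open>
  Convergence in the square integrable functions passes to integrals against a fixed square
  integrable \<open>g\<close>, by the Cauchy-Schwarz inequality. Taking \<open>g\<close> to be a basis function identifies
  coefficients; taking \<open>f = T g\<close> for the integral operator \<open>T\<close> gives its quadratic form.
\<close>

lemma L2_sums_integral:
  assumes s: "L2_sums M \<psi> c f" and \<psi>: "\<And>i. square_integrable M (\<psi> i)"
    and g: "square_integrable M g"
  shows "(\<lambda>i. c i * (\<integral>x. g x * \<psi> i x \<partial>M)) sums (\<integral>x. g x * f x \<partial>M)"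
proof -
  have f: "square_integrable M f" using s by (simp add: L2_sums_def)
  define p where "p N x = (\<Sum>i<N. c i * \<psi> i x)" for N x
  have p: "square_integrable M (p N)" for N
    unfolding p_def by (intro square_integrable_sum square_integrable_scale \<psi>)
  define e where "e N = (\<integral>x. (f x - p N x)\<^sup>2 \<partial>M)" for N
  have e: "e \<longlonglongrightarrow> 0" using s unfolding L2_sums_def e_def p_def by blast
  have part: "(\<Sum>i<N. c i * (\<integral>x. g x * \<psi> i x \<partial>M)) = (\<integral>x. g x * p N x \<partial>M)" for N
  proof -
    have "(\<integral>x. g x * p N x \<partial>M) = (\<integral>x. (\<Sum>i<N. c i * (g x * \<psi> i x)) \<partial>M)"
      by (simp only: p_def sum_distrib_left mult.left_commute)
    also have "\<dots> = (\<Sum>i<N. c i * (\<integral>x. g x * \<psi> i x \<partial>M))"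
      using square_integrable_mult[OF g \<psi>] by simp
    finally show ?thesis by simp
  qed
  have bound: "\<bar>(\<integral>x. g x * p N x \<partial>M) - (\<integral>x. g x * f x \<partial>M)\<bar> \<le> sqrt ((\<integral>x. (g x)\<^sup>2 \<partial>M) * e N)" for N
  proof -
    have "(\<integral>x. g x * p N x \<partial>M) - (\<integral>x. g x * f x \<partial>M) = - (\<integral>x. g x * (f x - p N x) \<partial>M)"
      using square_integrable_mult[OF g f] square_integrable_mult[OF g p[of N]]
      by (simp add: right_diff_distrib)
    moreover have "(\<integral>x. g x * (f x - p N x) \<partial>M)\<^sup>2 \<le> (\<integral>x. (g x)\<^sup>2 \<partial>M) * e N"
      unfolding e_def by (intro L2_Cauchy_Schwarz g square_integrable_diff f p)
    ultimately show ?thesis by (simp add: real_le_rsqrt)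
  qed
  have "(\<lambda>N. sqrt ((\<integral>x. (g x)\<^sup>2 \<partial>M) * e N)) \<longlonglongrightarrow> sqrt ((\<integral>x. (g x)\<^sup>2 \<partial>M) * 0)"
    by (intro tendsto_intros e)
  then have lim0: "(\<lambda>N. sqrt ((\<integral>x. (g x)\<^sup>2 \<partial>M) * e N)) \<longlonglongrightarrow> 0"
    by simp
  have "(\<lambda>N. (\<integral>x. g x * p N x \<partial>M) - (\<integral>x. g x * f x \<partial>M)) \<longlonglongrightarrow> 0"
    by (rule Lim_null_comparison[OF _ lim0]) (simp add: bound)
  then have "(\<lambda>N. \<integral>x. g x * p N x \<partial>M) \<longlonglongrightarrow> (\<integral>x. g x * f x \<partial>M)"
    by (rule LIM_zero_cancel)
  then show ?thesis unfolding sums_def part .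
qed

lemma L2_sums_coeff:
  assumes s: "L2_sums M \<psi> c f" and \<psi>: "\<And>i. square_integrable M (\<psi> i)"
    and orth: "\<And>i j. (\<integral>x. \<psi> i x * \<psi> j x \<partial>M) = (if i = j then 1 else 0)"
  shows "L2_coeff M \<psi> f i = c i"
proof -
  have "(\<lambda>j. c j * (\<integral>x. \<psi> i x * \<psi> j x \<partial>M)) sums (\<integral>x. \<psi> i x * f x \<partial>M)"
    by (rule L2_sums_integral[OF s \<psi> \<psi>])
  moreover have "(\<lambda>j. c j * (\<integral>x. \<psi> i x * \<psi> j x \<partial>M)) = (\<lambda>j. if j = i then c j else 0)"
    by (auto simp: orth)
  ultimately have "(\<lambda>j. if j = i then c j else 0) sums L2_coeff M \<psi> f i"
    by (simp add: L2_coeff_def mult.commute)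
  then show ?thesis using sums_unique2 sums_single by blast
qed

text \<open>
  Restrict \<open>f\<close> to large sets of finite measure; the restriction is integrable as a product of
  two square integrable functions.
\<close>

lemma L2_approx_integrable:
  assumes "sigma_finite_measure M" and f: "square_integrable M f" and "0 < \<delta>"
  shows "\<exists>g. square_integrable M g \<and> integrable M g \<and> (\<integral>x. (f x - g x)\<^sup>2 \<partial>M) < \<delta>"
proof -
  interpret sigma_finite_measure M by fact
  have [measurable]: "f \<in> borel_measurable M" and f2: "integrable M (\<lambda>x. (f x)\<^sup>2)"
    using f by (auto simp: square_integrable_def)
  obtain A :: "nat \<Rightarrow> _" where A: "range A \<subseteq> sets M" "(\<Union>i. A i) = space M"
    "\<And>i. emeasure M (A i) \<noteq> \<infinity>" "incseq A"
    using sigma_finite_incseq by blast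
  have [measurable]: "A k \<in> sets M" for k using A by auto
  define g where "g k x = indicator (A k) x * f x" for k x
  have "square_integrable M (g k)" for k
    unfolding square_integrable_def g_def power_mult_distrib
    by (auto intro!: Bochner_Integration.integrable_bound[OF f2] simp: indicator_def)
  moreover have "integrable M (g k)" for k
  proof -
    have "square_integrable M (indicator (A k))"
    proof -
      have "integrable M (indicator (A k) :: _ \<Rightarrow> real)"
        using A(3)[of k] by (intro integrable_real_indicator) (auto simp: less_top)
      moreover have "(\<lambda>x. (indicator (A k) x :: real)\<^sup>2) = indicator (A k)"
        by (auto simp: indicator_def)
      ultimately show ?thesis by (simp add: square_integrable_def)
    qed
    from square_integrable_mult[OF this f] show ?thesis by (simp add: g_def[abs_def])
  qed
  moreover have "\<exists>k. (\<integral>x. (f x - g k x)\<^sup>2 \<partial>M) < \<delta>"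
  proof -
    have "(\<lambda>k. \<integral>x. (f x - g k x)\<^sup>2 \<partial>M) \<longlonglongrightarrow> (\<integral>x. 0 \<partial>M)"
    proof (rule integral_dominated_convergence[where w = "\<lambda>x. (f x)\<^sup>2"])
      show "AE x in M. (\<lambda>k. (f x - g k x)\<^sup>2) \<longlonglongrightarrow> 0"
      proof (rule AE_I2)
        fix x assume "x \<in> space M"
        then obtain N where N: "x \<in> A N" using A(2) by auto
        then have "x \<in> A k" if "k \<ge> N" for k using \<open>incseq A\<close> that by (auto simp: incseq_def)
        then have "\<forall>\<^sub>F k in sequentially. (f x - g k x)\<^sup>2 = 0"
          by (auto simp: g_def eventually_sequentially intro!: exI[of _ N])
        then show "(\<lambda>k. (f x - g k x)\<^sup>2) \<longlonglongrightarrow> 0" by (rule tendsto_eventually)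
      qed
      show "AE x in M. norm ((f x - g k x)\<^sup>2) \<le> (f x)\<^sup>2" for k
        by (auto simp: g_def indicator_def)
    qed (auto simp: g_def f2)
    then have "\<forall>\<^sub>F k in sequentially. (\<integral>x. (f x - g k x)\<^sup>2 \<partial>M) < \<delta>"
      using \<open>0 < \<delta>\<close> by (simp add: order_tendsto_iff)
    then show ?thesis by (auto simp: eventually_sequentially)
  qed
  ultimately show ?thesis by blast
qed

section \<open>The adjoint of the embedding into the square integrable functions\<close>

locale square_integrable_rkhs =
  fixes M :: "'a measure" and K :: "'a \<Rightarrow> 'a \<Rightarrow> real"
    and fn :: "'h::{real_inner, complete_space} \<Rightarrow> 'a \<Rightarrow> real"
  assumes rkhs: "rkhs (space M) K fn"
    and square_integrable_fn: "\<And>h. square_integrable M (fn h)"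
begin

lemma fn_add: "x \<in> space M \<Longrightarrow> fn (f + g) x = fn f x + fn g x"
  using rkhs by (simp add: rkhs_def)

lemma fn_scaleR: "x \<in> space M \<Longrightarrow> fn (c *\<^sub>R f) x = c * fn f x"
  using rkhs by (simp add: rkhs_def)

lemma kernel_section:
  assumes "x \<in> space M"
  obtains k where "\<And>y. y \<in> space M \<Longrightarrow> fn k y = K x y" "\<And>f. fn f x = f \<bullet> k"
proof -
  have "\<exists>k. (\<forall>y\<in>space M. fn k y = K x y) \<and> (\<forall>f. fn f x = f \<bullet> k)"
    using rkhs assms unfolding rkhs_def by (elim conjE) (rule bspec)
  then obtain k where "\<forall>y\<in>space M. fn k y = K x y" "\<forall>f. fn f x = f \<bullet> k"
    by (elim exE conjE)
  then show thesis by (intro that[of k]) simp_all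
qed

lemma tendsto_fn:
  assumes "X \<longlonglongrightarrow> h" "x \<in> space M"
  shows "(\<lambda>n. fn (X n) x) \<longlonglongrightarrow> fn h x"
proof -
  obtain k where k: "\<And>f. fn f x = f \<bullet> k" using kernel_section[OF assms(2)] by metis
  show ?thesis unfolding k by (intro tendsto_intros assms)
qed

text \<open>
  Norm convergence in a reproducing kernel Hilbert space implies pointwise convergence, so
  Fatou's lemma applies.
\<close>

lemma closed_L2_ball: "closed {h. (\<integral>x. (fn h x)\<^sup>2 \<partial>M) \<le> c}"
proof (cases "0 \<le> c")
  case True
  note [measurable] = square_integrable_measurable[OF square_integrable_fn]
  have nn: "(\<integral>x. (fn h x)\<^sup>2 \<partial>M) \<le> c \<longleftrightarrow> (\<integral>\<^sup>+x. ennreal ((fn h x)\<^sup>2) \<partial>M) \<le> ennreal c" for h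
    using square_integrable_fn[of h] True by (simp add: nn_integral_eq_integral square_integrable_def)
  show ?thesis
    unfolding closed_sequential_limits mem_Collect_eq nn
  proof (intro allI impI, elim conjE)
    fix X h assume le: "\<forall>n. (\<integral>\<^sup>+x. ennreal ((fn (X n) x)\<^sup>2) \<partial>M) \<le> ennreal c" and X: "X \<longlonglongrightarrow> h"
    have "(\<integral>\<^sup>+x. ennreal ((fn h x)\<^sup>2) \<partial>M) = (\<integral>\<^sup>+x. liminf (\<lambda>n. ennreal ((fn (X n) x)\<^sup>2)) \<partial>M)"
    proof (intro nn_integral_cong)
      fix x assume "x \<in> space M"
      then have "(\<lambda>n. ennreal ((fn (X n) x)\<^sup>2)) \<longlonglongrightarrow> ennreal ((fn h x)\<^sup>2)"
        by (intro tendsto_ennrealI tendsto_intros tendsto_fn X)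
      then show "ennreal ((fn h x)\<^sup>2) = liminf (\<lambda>n. ennreal ((fn (X n) x)\<^sup>2))"
        by (intro lim_imp_Liminf[symmetric]) auto
    qed
    also have "\<dots> \<le> liminf (\<lambda>n. \<integral>\<^sup>+x. ennreal ((fn (X n) x)\<^sup>2) \<partial>M)"
      by (rule nn_integral_liminf) measurable
    also have "\<dots> \<le> ennreal c"
      using le Liminf_mono[of "\<lambda>n. \<integral>\<^sup>+x. ennreal ((fn (X n) x)\<^sup>2) \<partial>M" "\<lambda>_. ennreal c" sequentially]
      by (simp add: Liminf_const)
    finally show "(\<integral>\<^sup>+x. ennreal ((fn h x)\<^sup>2) \<partial>M) \<le> ennreal c" .
  qed
next
  case False
  have "\<not> (\<integral>x. (fn h x)\<^sup>2 \<partial>M) \<le> c" for h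
  proof -
    have "0 \<le> (\<integral>x. (fn h x)\<^sup>2 \<partial>M)" by simp
    with False show ?thesis by linarith
  qed
  then show ?thesis by simp
qed

text \<open>
  A Baire category argument in place of the closed graph theorem: the closed sets on which the
  \<open>L\<^sup>2\<close> norm is bounded by a constant exhaust the Hilbert space, so one of them contains a ball,
  and the embedding is bounded near \<open>0\<close>.
\<close>

lemma embedding_bounded: "\<exists>B>0. \<forall>h. (\<integral>x. (fn h x)\<^sup>2 \<partial>M) \<le> (B * norm h)\<^sup>2"
proof -
  define E where "E n = {h. (\<integral>x. (fn h x)\<^sup>2 \<partial>M) \<le> real n}" for n
  have "(\<Union>n. E n) = UNIV" by (auto simp: E_def real_arch_simple)
  then have U: "\<Union>(range E) = UNIV" by simp
  have "\<exists>n. interior (E n) \<noteq> {}"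
  proof (rule ccontr)
    assume "\<not> ?thesis"
    then have "closedin Met_TC.mtopology T \<and> Met_TC.mtopology interior_of T = {}" if "T \<in> range E" for T
      using that closed_L2_ball by (auto simp: E_def)
    then have "Met_TC.mtopology interior_of \<Union>(range E) = {}"
      by (intro Met_TC.metric_Baire_category_alt) (auto simp: complete_UNIV)
    then show False unfolding U by simp
  qed
  then obtain n c e where e: "e > 0" "ball c e \<subseteq> E n"
    by (meson all_not_in_conv mem_interior)
  \<comment> \<open>Functions of norm below \<open>e\<close> have squared \<open>L\<^sup>2\<close> norm at most \<open>4 * n\<close>; \<open>2 / e\<close> comes from
    scaling \<open>h\<close> to norm \<open>e / 2\<close>.\<close>
  define B where "B = sqrt (4 * real n + 1) * (2 / e)"
  have "B > 0" using e by (simp add: B_def)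
  have near: "(\<integral>x. (fn h x)\<^sup>2 \<partial>M) \<le> 4 * real n" if "norm h < e" for h
  proof -
    have "c + h \<in> E n" "c \<in> E n" using that e by (auto simp: dist_norm)
    then have E: "(\<integral>x. (fn (c + h) x)\<^sup>2 \<partial>M) \<le> real n" "(\<integral>x. (fn c x)\<^sup>2 \<partial>M) \<le> real n"
      by (auto simp: E_def)
    have "(\<integral>x. (fn h x)\<^sup>2 \<partial>M) \<le> (\<integral>x. 2 * (fn (c + h) x)\<^sup>2 + 2 * (fn c x)\<^sup>2 \<partial>M)"
    proof (rule integral_mono)
      fix x assume "x \<in> space M"
      then have "fn h x = fn (c + h) x - fn c x" by (simp add: fn_add)
      moreover have "(a - b)\<^sup>2 \<le> 2 * a\<^sup>2 + 2 * b\<^sup>2" for a b :: real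
        using zero_le_power2[of "a + b"] by (simp add: power2_diff power2_sum)
      ultimately show "(fn h x)\<^sup>2 \<le> 2 * (fn (c + h) x)\<^sup>2 + 2 * (fn c x)\<^sup>2" by simp
    qed (use square_integrable_fn in \<open>auto simp: square_integrable_def\<close>)
    also have "\<dots> = 2 * (\<integral>x. (fn (c + h) x)\<^sup>2 \<partial>M) + 2 * (\<integral>x. (fn c x)\<^sup>2 \<partial>M)"
      using square_integrable_fn by (simp add: square_integrable_def)
    finally show ?thesis using E by linarith
  qed
  have "(\<integral>x. (fn h x)\<^sup>2 \<partial>M) \<le> (B * norm h)\<^sup>2" for h
  proof (cases "h = 0")
    case True
    have "fn 0 x = 0" if "x \<in> space M" for x using fn_scaleR[OF that, of 0 0] by simp
    then have "(\<integral>x. (fn 0 x)\<^sup>2 \<partial>M) = (\<integral>x. 0 \<partial>M)" by (intro Bochner_Integration.integral_cong) auto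
    then show ?thesis using True by simp
  next
    case False
    define s where "s = e / (2 * norm h)"
    have s: "s > 0" using e False by (simp add: s_def)
    have "(\<integral>x. (fn (s *\<^sub>R h) x)\<^sup>2 \<partial>M) = s\<^sup>2 * (\<integral>x. (fn h x)\<^sup>2 \<partial>M)"
      by (subst integral_mult_right_zero[symmetric], intro Bochner_Integration.integral_cong)
         (auto simp: fn_scaleR power_mult_distrib)
    moreover have "norm (s *\<^sub>R h) < e" using e False by (simp add: s_def)
    ultimately have "s\<^sup>2 * (\<integral>x. (fn h x)\<^sup>2 \<partial>M) \<le> 4 * real n + 1"
      using near[of "s *\<^sub>R h"] by simp
    then have "(\<integral>x. (fn h x)\<^sup>2 \<partial>M) \<le> (4 * real n + 1) / s\<^sup>2"
      using s by (simp add: pos_le_divide_eq mult.commute)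
    also have "\<dots> = (B * norm h)\<^sup>2"
      using False e by (simp add: B_def s_def power_mult_distrib power_divide field_simps)
    finally show ?thesis .
  qed
  with \<open>B > 0\<close> show ?thesis by blast
qed

text \<open>
  The Hilbert space adjoint of the embedding \<open>fn\<close> into the square integrable functions; the
  value is meaningful for square integrable arguments.
\<close>

definition adj :: "('a \<Rightarrow> real) \<Rightarrow> 'h" where
  "adj f = (SOME u. \<forall>h. u \<bullet> h = (\<integral>x. f x * fn h x \<partial>M))"

lemma adj:
  assumes f: "square_integrable M f"
  shows "adj f \<bullet> h = (\<integral>x. f x * fn h x \<partial>M)"
proof -
  obtain B where B: "B > 0" "\<And>h. (\<integral>x. (fn h x)\<^sup>2 \<partial>M) \<le> (B * norm h)\<^sup>2"
    using embedding_bounded by blast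
  note int = square_integrable_mult[OF f square_integrable_fn]
  have "bounded_linear (\<lambda>h. \<integral>x. f x * fn h x \<partial>M)"
  proof (rule bounded_linear_intro)
    show "(\<integral>x. f x * fn (g + h) x \<partial>M) = (\<integral>x. f x * fn g x \<partial>M) + (\<integral>x. f x * fn h x \<partial>M)" for g h
      by (subst Bochner_Integration.integral_add[OF int int, symmetric], intro Bochner_Integration.integral_cong)
         (auto simp: fn_add distrib_left)
    show "(\<integral>x. f x * fn (c *\<^sub>R h) x \<partial>M) = c *\<^sub>R (\<integral>x. f x * fn h x \<partial>M)" for c h
      unfolding real_scaleR_def
      by (subst integral_mult_right_zero[symmetric], intro Bochner_Integration.integral_cong)
         (auto simp: fn_scaleR)
    show "norm (\<integral>x. f x * fn h x \<partial>M) \<le> norm h * (sqrt (\<integral>x. (f x)\<^sup>2 \<partial>M) * B)" for h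
    proof -
      have "(\<integral>x. f x * fn h x \<partial>M)\<^sup>2 \<le> (\<integral>x. (f x)\<^sup>2 \<partial>M) * (\<integral>x. (fn h x)\<^sup>2 \<partial>M)"
        by (rule L2_Cauchy_Schwarz[OF f square_integrable_fn])
      also have "\<dots> \<le> (\<integral>x. (f x)\<^sup>2 \<partial>M) * (B * norm h)\<^sup>2"
        by (intro mult_left_mono B) simp
      also have "\<dots> = (norm h * (sqrt (\<integral>x. (f x)\<^sup>2 \<partial>M) * B))\<^sup>2"
        by (simp add: power_mult_distrib)
      finally show ?thesis
        using B(1) by (simp add: abs_le_square_iff[symmetric] abs_mult)
    qed
  qed
  from riesz_representation[OF this] have "\<forall>h. adj f \<bullet> h = (\<integral>x. f x * fn h x \<partial>M)"
    unfolding adj_def by (rule someI_ex)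
  then show ?thesis ..
qed

lemma adj_eqI:
  assumes "square_integrable M f" "\<And>h. u \<bullet> h = (\<integral>x. f x * fn h x \<partial>M)"
  shows "adj f = u"
  using assms by (intro vector_eq_rdot[THEN iffD1]) (simp add: adj)

lemma adj_diff:
  assumes "square_integrable M f" "square_integrable M g"
  shows "adj (\<lambda>x. f x - g x) = adj f - adj g"
  using assms square_integrable_mult[OF _ square_integrable_fn]
  by (intro adj_eqI square_integrable_diff) (auto simp: adj inner_diff_left left_diff_distrib)

lemma adj_lincomb:
  assumes "\<And>i. i \<in> I \<Longrightarrow> square_integrable M (f i)"
  shows "adj (\<lambda>x. \<Sum>i\<in>I. c i * f i x) = (\<Sum>i\<in>I. c i *\<^sub>R adj (f i))"
  using assms square_integrable_mult[OF _ square_integrable_fn]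
  by (intro adj_eqI square_integrable_sum square_integrable_scale)
     (auto simp: adj inner_sum_left sum_distrib_right mult.assoc)

lemma norm_adj_bound:
  obtains B where "B > 0"
    "\<And>f. square_integrable M f \<Longrightarrow> (norm (adj f))\<^sup>2 \<le> B * (\<integral>x. (f x)\<^sup>2 \<partial>M)"
proof -
  obtain B where B: "B > 0" "\<And>h. (\<integral>x. (fn h x)\<^sup>2 \<partial>M) \<le> (B * norm h)\<^sup>2"
    using embedding_bounded by blast
  have "(norm (adj f))\<^sup>2 \<le> B\<^sup>2 * (\<integral>x. (f x)\<^sup>2 \<partial>M)" if f: "square_integrable M f" for f
  proof (cases "adj f = 0")
    case False
    have "(norm (adj f))\<^sup>2 * (norm (adj f))\<^sup>2 = (\<integral>x. f x * fn (adj f) x \<partial>M)\<^sup>2"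
      by (simp add: adj[OF f, symmetric] dot_square_norm power2_eq_square)
    also have "\<dots> \<le> (\<integral>x. (f x)\<^sup>2 \<partial>M) * (\<integral>x. (fn (adj f) x)\<^sup>2 \<partial>M)"
      by (rule L2_Cauchy_Schwarz[OF f square_integrable_fn])
    also have "\<dots> \<le> (\<integral>x. (f x)\<^sup>2 \<partial>M) * (B * norm (adj f))\<^sup>2"
      by (intro mult_left_mono B) simp
    also have "\<dots> = (norm (adj f))\<^sup>2 * (B\<^sup>2 * (\<integral>x. (f x)\<^sup>2 \<partial>M))"
      by (simp add: power_mult_distrib)
    finally show ?thesis using False by (subst (asm) mult_le_cancel_left) simp
  qed simp
  then show thesis using that[of "B\<^sup>2"] B(1) by simp
qed

text \<open>
  Evaluation at \<open>x\<close> is the inner product with the kernel section at \<open>x\<close>, so the adjoint followed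
  by the embedding is the integral operator.
\<close>

lemma fn_adj:
  assumes f: "square_integrable M f" and x: "x \<in> space M"
  shows "fn (adj f) x = integral_op M K f x"
proof -
  obtain k where k: "\<And>y. y \<in> space M \<Longrightarrow> fn k y = K x y" "\<And>f. fn f x = f \<bullet> k"
    using kernel_section[OF x] by metis
  have "fn (adj f) x = (\<integral>y. f y * fn k y \<partial>M)" by (simp add: k(2) adj[OF f])
  also have "\<dots> = integral_op M K f x"
    unfolding integral_op_def by (intro Bochner_Integration.integral_cong) (auto simp: k mult.commute)
  finally show ?thesis .
qed

lemma adj_inner_adj:
  assumes "square_integrable M f" "square_integrable M g"
  shows "adj f \<bullet> adj g = (\<integral>x. f x * integral_op M K g x \<partial>M)"
  unfolding adj[OF assms(1)] by (intro Bochner_Integration.integral_cong) (auto simp: fn_adj assms)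

end

section \<open>Mercer expansion of the adjoint\<close>

text \<open>
  Since the eigenvalues are non-increasing, a polynomial lower bound on their decay forces all
  of them to be positive, which makes negative powers of the operator meaningful.
\<close>

locale mercer_rkhs = square_integrable_rkhs M K fn
  for M :: "'a measure" and K and fn :: "'h::{real_inner, complete_space} \<Rightarrow> 'a \<Rightarrow> real" +
  fixes t :: "nat \<Rightarrow> real" and \<psi> :: "nat \<Rightarrow> 'a \<Rightarrow> real"
  assumes mercer: "mercer_system M K t \<psi>" and t_pos: "\<And>i. t i > 0"
begin

lemma square_integrable_\<psi>: "square_integrable M (\<psi> i)"
  and orthonormal: "(\<integral>x. \<psi> i x * \<psi> j x \<partial>M) = (if i = j then 1 else 0)"
  and antimono_t: "antimono t"
  and mercer_expansion: "square_integrable M f \<Longrightarrow>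
        L2_sums M \<psi> (\<lambda>i. t i * L2_coeff M \<psi> f i) (integral_op M K f)"
  using mercer by (auto simp: mercer_system_def)

text \<open>
  \<open>(norm (adj f))\<^sup>2\<close> is the quadratic form \<open>\<integral> f T f\<close> of the integral operator \<open>T\<close>, which the
  Mercer expansion diagonalises.
\<close>

lemma norm_adj_sums:
  assumes f: "square_integrable M f"
  shows "(\<lambda>i. t i * (L2_coeff M \<psi> f i)\<^sup>2) sums (norm (adj f))\<^sup>2"
proof -
  have "(\<lambda>i. t i * L2_coeff M \<psi> f i * (\<integral>x. f x * \<psi> i x \<partial>M)) sums (\<integral>x. f x * integral_op M K f x \<partial>M)"
    by (rule L2_sums_integral[OF mercer_expansion[OF f] square_integrable_\<psi> f])
  then show ?thesis
    by (simp add: adj_inner_adj[OF f f, symmetric] dot_square_norm L2_coeff_def power2_eq_square mult.assoc)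
qed

lemma L2_coeff_lincomb:
  assumes "finite I"
  shows "L2_coeff M \<psi> (\<lambda>x. \<Sum>j\<in>I. c j * \<psi> j x) i = (if i \<in> I then c i else 0)"
proof -
  have "L2_coeff M \<psi> (\<lambda>x. \<Sum>j\<in>I. c j * \<psi> j x) i = (\<Sum>j\<in>I. c j * (\<integral>x. \<psi> j x * \<psi> i x \<partial>M))"
    unfolding L2_coeff_def sum_distrib_right mult.assoc
    by (subst Bochner_Integration.integral_sum)
       (auto intro: square_integrable_mult square_integrable_\<psi>)
  also have "\<dots> = (if i \<in> I then c i else 0)"
    using assms by (simp add: orthonormal if_distrib[of "(*) _"] cong: if_cong)
  finally show ?thesis .
qed

lemma L2_coeff_diff:
  assumes "square_integrable M f" "square_integrable M g"
  shows "L2_coeff M \<psi> (\<lambda>x. f x - g x) i = L2_coeff M \<psi> f i - L2_coeff M \<psi> g i"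
  using assms square_integrable_mult[OF _ square_integrable_\<psi>]
  by (simp add: L2_coeff_def left_diff_distrib)

text \<open>
  The vectors \<open>adj (\<psi> i)\<close> are orthogonal in the Hilbert space with squared norms \<open>t i\<close>, and the
  inner product of \<open>h\<close> with \<open>adj (\<psi> i)\<close> is the \<open>i\<close>-th coefficient of \<open>fn h\<close>. This is Bessel's
  inequality for that system.
\<close>

lemma Bessel_rkhs:
  "(\<Sum>i<N. (L2_coeff M \<psi> (fn h) i)\<^sup>2 / t i) \<le> (norm h)\<^sup>2"
proof -
  define a where "a = L2_coeff M \<psi> (fn h)"
  \<comment> \<open>\<open>adj f\<close> is the orthogonal projection of \<open>h\<close> onto the span of the first \<open>N\<close> vectors.\<close>
  define f where "f x = (\<Sum>i<N. a i / t i * \<psi> i x)" for x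
  have f: "square_integrable M f"
    unfolding f_def by (intro square_integrable_sum square_integrable_scale square_integrable_\<psi>)
  have "L2_coeff M \<psi> f i = (if i < N then a i / t i else 0)" for i
    unfolding f_def by (subst L2_coeff_lincomb) auto
  then have terms: "t i * (L2_coeff M \<psi> f i)\<^sup>2 = (if i \<in> {..<N} then (a i)\<^sup>2 / t i else 0)" for i
    using t_pos[of i] by (simp add: power2_eq_square)
  have "(norm (adj f))\<^sup>2 = (\<Sum>i<N. (a i)\<^sup>2 / t i)"
    using norm_adj_sums[OF f] sums_If_finite_set[of "{..<N}" "\<lambda>i. (a i)\<^sup>2 / t i"]
    unfolding terms by (rule sums_unique2[OF _ _]) simp
  moreover have "adj f \<bullet> h = (\<Sum>i<N. (a i)\<^sup>2 / t i)"
  proof -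
    have "adj f \<bullet> h = (\<integral>x. (\<Sum>i<N. a i / t i * (fn h x * \<psi> i x)) \<partial>M)"
      unfolding adj[OF f] f_def sum_distrib_right by (simp only: mult_ac)
    also have "\<dots> = (\<Sum>i<N. a i / t i * (\<integral>x. fn h x * \<psi> i x \<partial>M))"
      using square_integrable_mult[OF square_integrable_fn square_integrable_\<psi>] by simp
    also have "\<dots> = (\<Sum>i<N. a i / t i * a i)"
      by (simp add: a_def L2_coeff_def)
    finally show ?thesis by (simp add: power2_eq_square)
  qed
  moreover have "0 \<le> (norm (h - adj f))\<^sup>2" by simp
  then have "0 \<le> (norm h)\<^sup>2 - 2 * (adj f \<bullet> h) + (norm (adj f))\<^sup>2"
    by (simp add: dot_square_norm[symmetric] inner_diff_left inner_diff_right inner_commute)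
  ultimately show ?thesis unfolding a_def by linarith
qed

end

section \<open>Signed measures with a density\<close>

text \<open>
  The supremum over measurable subsets of \<open>A\<close> is attained at the part of \<open>A\<close> on which \<open>g\<close> is
  positive (Hahn decomposition); \<open>ennreal\<close> truncates negative values, so \<open>ennreal (g x)\<close> is the
  positive part.
\<close>

lemma upper_variation_density:
  assumes g: "integrable M g"
    and \<sigma>: "\<And>B. B \<in> sets M \<Longrightarrow> \<sigma> B = (\<integral>x. indicator B x * g x \<partial>M)"
  shows "upper_variation M \<sigma> = density M (\<lambda>x. ennreal (g x))"
proof -
  have [measurable]: "g \<in> borel_measurable M" using g by auto
  have int: "integrable M (\<lambda>x. indicator B x * f x)" if "B \<in> sets M" "integrable M f" for B and f :: "'a \<Rightarrow> real"
    using integrable_mult_indicator[OF that] by simp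
  have g_pos: "integrable M (\<lambda>x. max 0 (g x))"
    by (rule Bochner_Integration.integrable_bound[OF g]) auto
  have "(SUP B\<in>{B \<in> sets M. B \<subseteq> A}. ennreal (\<sigma> B)) = emeasure (density M (\<lambda>x. ennreal (g x))) A"
    (is "?S = ?R") if A[measurable]: "A \<in> sets M" for A
  proof (rule antisym)
    show "?S \<le> ?R"
    proof (rule SUP_least)
      fix B assume "B \<in> {B \<in> sets M. B \<subseteq> A}"
      then have B[measurable]: "B \<in> sets M" and "B \<subseteq> A" by auto
      have "\<sigma> B \<le> (\<integral>x. indicator B x * max 0 (g x) \<partial>M)"
        unfolding \<sigma>[OF B]
      proof (rule integral_mono)
        show "indicator B x * g x \<le> indicator B x * max 0 (g x)" for x
          by (intro mult_left_mono) auto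
      qed (use int[OF B g] int[OF B g_pos] in auto)
      then have "ennreal (\<sigma> B) \<le> ennreal (\<integral>x. indicator B x * max 0 (g x) \<partial>M)" by (rule ennreal_leI)
      also have "\<dots> = (\<integral>\<^sup>+x. ennreal (indicator B x * max 0 (g x)) \<partial>M)"
        using g B by (intro nn_integral_eq_integral[symmetric] int g_pos) auto
      also have "\<dots> \<le> (\<integral>\<^sup>+x. ennreal (g x) * indicator A x \<partial>M)"
        using \<open>B \<subseteq> A\<close> by (intro nn_integral_mono) (auto simp: indicator_def max_def ennreal_neg)
      also have "\<dots> = ?R" by (simp add: emeasure_density)
      finally show "ennreal (\<sigma> B) \<le> ?R" .
    qed
    define P where "P = {x \<in> space M. 0 < g x} \<inter> A"
    have P: "P \<in> sets M" "P \<subseteq> A" by (auto simp: P_def)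
    have "?R = (\<integral>\<^sup>+x. ennreal (g x) * indicator A x \<partial>M)" by (simp add: emeasure_density)
    also have "\<dots> = (\<integral>\<^sup>+x. ennreal (indicator P x * g x) \<partial>M)"
      by (intro nn_integral_cong) (auto simp: P_def indicator_def ennreal_neg)
    also have "\<dots> = ennreal (\<integral>x. indicator P x * g x \<partial>M)"
      using int[OF P(1) g] by (intro nn_integral_eq_integral) (auto simp: P_def indicator_def)
    also have "\<dots> = ennreal (\<sigma> P)" by (simp add: \<sigma> P)
    also have "\<dots> \<le> ?S" using P by (intro SUP_upper) auto
    finally show "?R \<le> ?S" .
  qed
  then have "upper_variation M \<sigma> = measure_of (space M) (sets M) (emeasure (density M (\<lambda>x. ennreal (g x))))"
    unfolding upper_variation_def by (intro measure_of_eq sets.space_closed) (simp add: sets.sigma_sets_eq)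
  also have "\<dots> = density M (\<lambda>x. ennreal (g x))"
    using measure_of_of_measure[of "density M (\<lambda>x. ennreal (g x))"] by simp
  finally show ?thesis .
qed

lemma signed_integral_density:
  assumes g: "integrable M g"
    and \<sigma>: "\<And>B. B \<in> sets M \<Longrightarrow> \<sigma> B = (\<integral>x. indicator B x * g x \<partial>M)"
    and f: "f \<in> borel_measurable M" and fg: "integrable M (\<lambda>x. g x * f x)"
  shows "signed_integrable M \<sigma> f" "signed_integral M \<sigma> f = (\<integral>x. g x * f x \<partial>M)"
proof -
  have [measurable]: "g \<in> borel_measurable M" using g by auto
  note [measurable] = f
  have "- \<sigma> B = (\<integral>x. indicator B x * - g x \<partial>M)" if "B \<in> sets M" for B
    using \<sigma>[OF that] by simp
  then have up: "upper_variation M \<sigma> = density M (\<lambda>x. ennreal (max 0 (g x)))"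
    "upper_variation M (\<lambda>B. - \<sigma> B) = density M (\<lambda>x. ennreal (max 0 (- g x)))"
    using upper_variation_density[OF g \<sigma>] upper_variation_density[of M "\<lambda>x. - g x" "\<lambda>B. - \<sigma> B"] g
    by (simp_all add: ennreal_max_0)
  have parts: "integrable M (\<lambda>x. max 0 (g x) * f x)" "integrable M (\<lambda>x. max 0 (- g x) * f x)"
    by (rule Bochner_Integration.integrable_bound[OF fg];
        force simp: abs_mult intro!: mult_right_mono AE_I2)+
  show "signed_integrable M \<sigma> f"
    unfolding signed_integrable_def up
  proof
    show "integrable (density M (\<lambda>x. ennreal (max 0 (g x)))) f"
      using parts(1) by (subst integrable_density) auto
    show "integrable (density M (\<lambda>x. ennreal (max 0 (- g x)))) f"
      using parts(2) by (subst integrable_density) auto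
  qed
  have "signed_integral M \<sigma> f = (\<integral>x. max 0 (g x) * f x \<partial>M) - (\<integral>x. max 0 (- g x) * f x \<partial>M)"
    unfolding signed_integral_def up by (subst (1 2) integral_density) auto
  also have "\<dots> = (\<integral>x. max 0 (g x) * f x - max 0 (- g x) * f x \<partial>M)"
    using parts by simp
  also have "\<dots> = (\<integral>x. g x * f x \<partial>M)"
    by (intro Bochner_Integration.integral_cong) (auto simp: max_def)
  finally show "signed_integral M \<sigma> f = (\<integral>x. g x * f x \<partial>M)" .
qed

lemma finite_signed_measure_density:
  assumes g: "integrable M g"
    and \<sigma>: "\<And>B. B \<in> sets M \<Longrightarrow> \<sigma> B = (\<integral>x. indicator B x * g x \<partial>M)"
  shows "finite_signed_measure M \<sigma>"
  unfolding finite_signed_measure_def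
proof (intro conjI allI impI)
  fix A :: "nat \<Rightarrow> 'a set" assume A: "range A \<subseteq> sets M" and disj: "disjoint_family A"
  have sets: "A i \<in> sets M" for i using A by auto
  have int: "set_integrable M B g" if "B \<in> sets M" for B
    unfolding set_integrable_def by (rule integrable_mult_indicator[OF that g])
  have "(\<lambda>n. LINT x:(\<Union>i<n. A i)|M. g x) \<longlonglongrightarrow> (LINT x:(\<Union>n. \<Union>i<n. A i)|M. g x)"
  proof (intro set_integral_cont_up int)
    show "incseq (\<lambda>n. \<Union>i<n. A i)" by (intro monoI UN_mono) auto
  qed (use sets in auto)
  moreover have "(\<Union>n. \<Union>i<n. A i) = (\<Union>i. A i)" by auto
  moreover have "(LINT x:(\<Union>i<n. A i)|M. g x) = (\<Sum>i<n. LINT x:A i|M. g x)" for n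
    using sets disj
    by (intro set_integral_finite_Union int) (auto simp: disjoint_family_on_def)
  moreover have "\<sigma> B = (LINT x:B|M. g x)" if "B \<in> sets M" for B
    using \<sigma>[OF that] by (simp add: set_lebesgue_integral_def)
  then have "\<sigma> (A i) = (LINT x:A i|M. g x)" "\<sigma> (\<Union>i. A i) = (LINT x:(\<Union>i. A i)|M. g x)" for i
    using sets by auto
  ultimately show "(\<lambda>i. \<sigma> (A i)) sums \<sigma> (\<Union>i. A i)"
    unfolding sums_def by simp
qed (simp add: \<sigma>)

context square_integrable_rkhs
begin
text \<open>
  Integrating \<open>fn h\<close> against the signed measure with density \<open>g\<close> gives \<open>adj g \<bullet> h\<close>, and the
  supremum over the unit ball of such a functional is the norm of its representing vector.
\<close>

lemma ipm_rkhs_ball: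
  assumes g1: "integrable M g" and g2: "square_integrable M g"
    and \<mu>: "\<And>B. B \<in> sets M \<Longrightarrow> \<mu> B - \<nu> B = (\<integral>x. indicator B x * g x \<partial>M)"
  shows "ipm M (rkhs_ball fn) \<mu> \<nu> = ereal (norm (adj g))"
proof -
  have *: "signed_integrable M (\<lambda>A. \<mu> A - \<nu> A) (fn h)"
    "signed_integral M (\<lambda>A. \<mu> A - \<nu> A) (fn h) = adj g \<bullet> h" for h
    using signed_integral_density[OF g1, of "\<lambda>A. \<mu> A - \<nu> A" "fn h"] \<mu>
      square_integrable_mult[OF g2 square_integrable_fn] square_integrable_measurable[OF square_integrable_fn]
    by (simp_all add: adj[OF g2])
  moreover have "rkhs_ball fn = fn ` {h. norm h \<le> 1}" by (auto simp: rkhs_ball_def)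
  ultimately have "ipm M (rkhs_ball fn) \<mu> \<nu> = (SUP f\<in>fn ` {h. norm h \<le> 1}. ereal (signed_integral M (\<lambda>A. \<mu> A - \<nu> A) f))"
    unfolding ipm_def by (intro SUP_cong) auto
  also have "\<dots> = (SUP h\<in>{h. norm h \<le> 1}. ereal (adj g \<bullet> h))"
    unfolding image_image by (simp only: *)
  finally show ?thesis by (simp only: Sup_inner_unit_ball)
qed

end

section \<open>Logarithmic orders of growth\<close>

lemma ennln_ennreal: "0 < x \<Longrightarrow> ennln (ennreal x) = ereal (ln x)"
  by (simp add: ennln_def ennreal_eq_0_iff)

lemma ennln_le:
  assumes "a \<le> ennreal x" "0 < x"
  shows "ennln a \<le> ereal (ln x)"
proof (cases a)
  case (real r)
  with assms show ?thesis by (cases "r = 0") (auto simp: ennln_ennreal, simp add: ennln_def)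
next
  case top
  with assms show ?thesis by (simp add: top_unique)
qed

text \<open>
  The constant \<open>D\<close> may depend on \<open>e\<close>: after dividing by \<open>ln n\<close>, the term \<open>ln D\<close> vanishes in the
  limit.
\<close>

lemma precsim_powI:
  assumes "\<And>e. e > 0 \<Longrightarrow> \<exists>D. \<forall>\<^sub>F n in sequentially. A n \<le> ennreal (D * real n powr (s + e))"
  shows "precsim_pow A s"
  unfolding precsim_pow_def
proof (rule ereal_le_epsilon2)
  fix e :: real assume e: "0 < e"
  obtain D' where D': "\<forall>\<^sub>F n in sequentially. A n \<le> ennreal (D' * real n powr (s + e / 2))"
    using assms[of "e / 2"] e by auto
  define D where "D = max D' 1"
  have D: "D > 0" "D \<ge> D'" by (auto simp: D_def)
  have "(\<lambda>n. ln D / ln (real n)) \<longlonglongrightarrow> 0"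
    by (intro real_tendsto_divide_at_top[OF tendsto_const]
        filterlim_compose[OF ln_at_top filterlim_real_sequentially])
  then have "\<forall>\<^sub>F n in sequentially. ln D / ln (real n) < e / 2"
    using e by (intro order_tendstoD(2)) auto
  then have "\<forall>\<^sub>F n in sequentially. ennln (A n) / ereal (ln (real n)) \<le> ereal (s + e)"
    using D' eventually_ge_at_top[of 2]
  proof eventually_elim
    case (elim n)
    have n: "0 < ln (real n)" using elim by simp
    have "D' * real n powr (s + e / 2) \<le> D * real n powr (s + e / 2)"
      using D by (intro mult_right_mono) auto
    then have "A n \<le> ennreal (D * real n powr (s + e / 2))"
      using elim(2) ennreal_leI order_trans by blast
    then have "ennln (A n) \<le> ereal (ln (D * real n powr (s + e / 2)))"
      using D elim(3) by (intro ennln_le) auto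
    also have "ln (D * real n powr (s + e / 2)) = ln D + (s + e / 2) * ln (real n)"
      using D elim(3) by (simp add: ln_mult ln_powr)
    finally have "ennln (A n) / ereal (ln (real n)) \<le> ereal (ln D + (s + e / 2) * ln (real n)) / ereal (ln (real n))"
      using n by (intro ereal_divide_right_mono) auto
    also have "\<dots> = ereal (ln D / ln (real n) + (s + e / 2))"
      using n by (simp add: add_divide_distrib)
    also have "\<dots> \<le> ereal (s + e)"
      using elim(1) unfolding ereal_less_eq(3) by linarith
    finally show ?case .
  qed
  then show "limsup (\<lambda>n. ennln (A n) / ereal (ln (real n))) \<le> ereal s + ereal e"
    by (intro Limsup_bounded) simp
qed

lemma precsim_powD:
  assumes "precsim_pow (\<lambda>i. ennreal (t i)) s" and pos: "\<And>i. 0 < t i" and "0 < e"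
  shows "\<forall>\<^sub>F i in sequentially. t i \<le> real i powr (s + e)"
proof -
  have "limsup (\<lambda>i. ennln (ennreal (t i)) / ereal (ln (real i))) \<le> ereal s"
    using assms(1) unfolding precsim_pow_def .
  also have "ereal s < ereal (s + e)" using \<open>0 < e\<close> by simp
  finally have "limsup (\<lambda>i. ennln (ennreal (t i)) / ereal (ln (real i))) < ereal (s + e)" .
  then have "\<forall>\<^sub>F i in sequentially. ennln (ennreal (t i)) / ereal (ln (real i)) < ereal (s + e)"
    by (rule Limsup_lessD)
  then show ?thesis
    using eventually_ge_at_top[of 2]
  proof eventually_elim
    case (elim i)
    have i: "0 < ln (real i)" using elim by simp
    then have "ln (t i) / ln (real i) < s + e"
      using elim(1) by (simp add: ennln_ennreal pos)
    then have "ln (t i) \<le> ln (real i powr (s + e))"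
      using i elim(2) by (simp add: ln_powr pos_divide_less_eq)
    then show ?case using pos[of i] elim(2) by (subst (asm) ln_le_cancel_iff) auto
  qed
qed

text \<open>
  A non-increasing sequence that reaches \<open>0\<close> stays at or below it, and then the logarithm is
  \<open>-\<infinity>\<close> from that index on.
\<close>

lemma succsim_pow_antimono_pos:
  assumes s: "succsim_pow (\<lambda>i. ennreal (t i)) s" and t: "antimono t"
  shows "0 < t i"
proof (rule ccontr)
  assume "\<not> 0 < t i"
  then have zero: "ennreal (t j) = 0" if "j \<ge> i" for j
    using antimonoD[OF t that] by (simp add: ennreal_eq_0_iff)
  have "ereal (s - 1) < ereal s" by simp
  also have "\<dots> \<le> liminf (\<lambda>i. ennln (ennreal (t i)) / ereal (ln (real i)))"
    using s unfolding succsim_pow_def .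
  finally have "ereal (s - 1) < liminf (\<lambda>i. ennln (ennreal (t i)) / ereal (ln (real i)))" .
  then have "\<forall>\<^sub>F i in sequentially. ereal (s - 1) < ennln (ennreal (t i)) / ereal (ln (real i))"
    by (rule less_LiminfD)
  then obtain N where N: "\<And>j. j \<ge> N \<Longrightarrow> ereal (s - 1) < ennln (ennreal (t j)) / ereal (ln (real j))"
    by (auto simp: eventually_sequentially)
  define j where "j = max i (max N 2)"
  have "0 < ln (real j)" by (simp add: j_def)
  moreover have "N \<le> j" "i \<le> j" by (simp_all add: j_def)
  ultimately show False using N[of j] zero[of j] by (simp add: ennln_def)
qed

section \<open>Sample means\<close>

lemma integral_PiM_component:
  fixes f :: "'a \<Rightarrow> real" and n :: nat
  assumes "prob_space \<nu>" "i < n" and f: "integrable \<nu> f"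
  shows "integrable (Pi\<^sub>M {..<n} (\<lambda>_. \<nu>)) (\<lambda>x. f (x i))"
    and "(\<integral>x. f (x i) \<partial>Pi\<^sub>M {..<n} (\<lambda>_. \<nu>)) = (\<integral>y. f y \<partial>\<nu>)"
proof -
  have d: "distr (Pi\<^sub>M {..<n} (\<lambda>_. \<nu>)) \<nu> (\<lambda>x. x i) = \<nu>"
    using assms distr_PiM_component[of "{..<n}" "\<lambda>_. \<nu>" i] by simp
  have m: "(\<lambda>x. x i) \<in> measurable (Pi\<^sub>M {..<n} (\<lambda>_. \<nu>)) \<nu>"
    using assms by (intro measurable_component_singleton) auto
  show "integrable (Pi\<^sub>M {..<n} (\<lambda>_. \<nu>)) (\<lambda>x. f (x i))"
    using integrable_distr[OF m, of f] f by (simp add: d)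
  show "(\<integral>x. f (x i) \<partial>Pi\<^sub>M {..<n} (\<lambda>_. \<nu>)) = (\<integral>y. f y \<partial>\<nu>)"
    using integral_distr[OF m, of f] f by (simp add: d)
qed

lemma integral_PiM_two_components:
  fixes f :: "'a \<Rightarrow> real" and n :: nat
  assumes "prob_space \<nu>" "i < n" "j < n" "i \<noteq> j" and f: "integrable \<nu> f"
  shows "integrable (Pi\<^sub>M {..<n} (\<lambda>_. \<nu>)) (\<lambda>x. f (x i) * f (x j))"
    and "(\<integral>x. f (x i) * f (x j) \<partial>Pi\<^sub>M {..<n} (\<lambda>_. \<nu>)) = (\<integral>y. f y \<partial>\<nu>)\<^sup>2"
proof -
  interpret prob_space \<nu> by fact
  interpret product_sigma_finite "\<lambda>_. \<nu>" by unfold_locales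
  define g where "g k = (if k \<in> {i, j} then f else (\<lambda>_. 1))" for k
  have g: "integrable \<nu> (g k)" for k using f by (simp add: g_def)
  have ij: "(\<Prod>k<n. if k \<in> {i, j} then a k else 1) = a i * a j" for a :: "nat \<Rightarrow> real"
  proof -
    have "(\<Prod>k<n. if k \<in> {i, j} then a k else 1) = (\<Prod>k\<in>{i, j}. a k)"
      using assms by (subst prod.inter_restrict[symmetric]) (auto intro!: prod.cong)
    then show ?thesis using assms by simp
  qed
  have eq: "(\<Prod>k<n. g k (x k)) = f (x i) * f (x j)" for x
    using ij[of "\<lambda>k. f (x k)"] by (simp add: g_def if_distrib[of "\<lambda>h. h _"] cong: if_cong)
  show "integrable (Pi\<^sub>M {..<n} (\<lambda>_. \<nu>)) (\<lambda>x. f (x i) * f (x j))"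
    using product_integrable_prod[of "{..<n}" g] g by (simp add: eq)
  have "(\<Prod>k<n. integral\<^sup>L \<nu> (g k)) = (\<integral>y. f y \<partial>\<nu>)\<^sup>2"
    using ij[of "\<lambda>k. integral\<^sup>L \<nu> f"]
    by (simp add: g_def if_distrib[of "integral\<^sup>L \<nu>"] prob_space power2_eq_square cong: if_cong)
  then show "(\<integral>x. f (x i) * f (x j) \<partial>Pi\<^sub>M {..<n} (\<lambda>_. \<nu>)) = (\<integral>y. f y \<partial>\<nu>)\<^sup>2"
    using product_integral_prod[of "{..<n}" g] g by (simp add: eq)
qed

definition sample_mean :: "nat \<Rightarrow> ('a \<Rightarrow> real) \<Rightarrow> (nat \<Rightarrow> 'a) \<Rightarrow> real" where
  "sample_mean n f x = (\<Sum>j<n. f (x j)) / real n"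

lemma sample_mean_measurable:
  assumes "f \<in> borel_measurable M"
  shows "sample_mean n f \<in> borel_measurable (Pi\<^sub>M {..<n} (\<lambda>_. M))"
proof -
  have "(\<lambda>x. f (x j)) \<in> borel_measurable (Pi\<^sub>M {..<n} (\<lambda>_. M))" if "j < n" for j
    using that by (intro measurable_compose[OF _ assms] measurable_component_singleton) auto
  then show ?thesis unfolding sample_mean_def[abs_def] by simp
qed

text \<open>
  Expand the square of the centred mean: independence makes the mixed terms vanish, and the \<open>n\<close>
  diagonal terms are the variance, which is at most the second moment.
\<close>

lemma sample_mean_mse:
  assumes \<nu>: "prob_space \<nu>" and f: "square_integrable \<nu> f" and n: "0 < n"
  shows "integrable (Pi\<^sub>M {..<n} (\<lambda>_. \<nu>)) (\<lambda>x. (sample_mean n f x - (\<integral>y. f y \<partial>\<nu>))\<^sup>2)"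
    and "(\<integral>x. (sample_mean n f x - (\<integral>y. f y \<partial>\<nu>))\<^sup>2 \<partial>Pi\<^sub>M {..<n} (\<lambda>_. \<nu>)) \<le> (\<integral>y. (f y)\<^sup>2 \<partial>\<nu>) / real n"
proof -
  interpret prob_space \<nu> by fact
  let ?P = "Pi\<^sub>M {..<n} (\<lambda>_. \<nu>)"
  define \<mu> where "\<mu> = (\<integral>y. f y \<partial>\<nu>)"
  define g where "g y = f y - \<mu>" for y
  have f2: "integrable \<nu> (\<lambda>y. (f y)\<^sup>2)" and fm: "f \<in> borel_measurable \<nu>"
    using f by (auto simp: square_integrable_def)
  have f1: "integrable \<nu> f" by (rule square_integrable_imp_integrable[OF fm f2])
  have g1: "integrable \<nu> g" and g0: "(\<integral>y. g y \<partial>\<nu>) = 0"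
    using f1 by (simp_all add: g_def[abs_def] \<mu>_def prob_space)
  have sq: "(g y)\<^sup>2 = (f y)\<^sup>2 - 2 * \<mu> * f y + \<mu>\<^sup>2" for y
    by (simp add: g_def power2_diff)
  have g2: "integrable \<nu> (\<lambda>y. (g y)\<^sup>2)" unfolding sq using f1 f2 by simp
  define v where "v = (\<integral>y. (g y)\<^sup>2 \<partial>\<nu>)"
  have v: "v \<le> (\<integral>y. (f y)\<^sup>2 \<partial>\<nu>)"
    unfolding v_def sq using f1 f2 by (simp add: \<mu>_def[symmetric] prob_space power2_eq_square)
  have cov: "integrable ?P (\<lambda>x. g (x i) * g (x j))"
    "(\<integral>x. g (x i) * g (x j) \<partial>?P) = (if i = j then v else 0)" if "i < n" "j < n" for i j
    using that integral_PiM_component[OF \<nu> that(1) g2] integral_PiM_two_components[OF \<nu> that _ g1] g0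
    by (cases "i = j"; simp add: power2_eq_square v_def)+
  have eq: "(sample_mean n f x - \<mu>)\<^sup>2 = (\<Sum>i<n. \<Sum>j<n. g (x i) * g (x j)) / (real n)\<^sup>2" for x
  proof -
    have "sample_mean n f x - \<mu> = (\<Sum>i<n. g (x i)) / real n"
      using n by (simp add: sample_mean_def g_def sum_subtractf field_simps)
    then show ?thesis by (simp add: power_divide power2_eq_square sum_product)
  qed
  show "integrable ?P (\<lambda>x. (sample_mean n f x - (\<integral>y. f y \<partial>\<nu>))\<^sup>2)"
    unfolding \<mu>_def[symmetric] eq using cov by (intro integrable_divide Bochner_Integration.integrable_sum) auto
  have "(\<integral>x. (\<Sum>i<n. \<Sum>j<n. g (x i) * g (x j)) \<partial>?P) = (\<Sum>i<n. \<integral>x. (\<Sum>j<n. g (x i) * g (x j)) \<partial>?P)"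
    by (intro Bochner_Integration.integral_sum Bochner_Integration.integrable_sum cov) auto
  also have "\<dots> = (\<Sum>i<n. \<Sum>j<n. \<integral>x. g (x i) * g (x j) \<partial>?P)"
    by (intro sum.cong refl Bochner_Integration.integral_sum cov) auto
  also have "\<dots> = (\<Sum>i<n. \<Sum>j<n. if i = j then v else 0)"
    by (intro sum.cong refl cov) auto
  also have "\<dots> = real n * v" by simp
  finally have "(\<integral>x. (sample_mean n f x - \<mu>)\<^sup>2 \<partial>?P) = v / real n"
    unfolding eq integral_divide_zero by (simp add: power2_eq_square)
  also have "\<dots> \<le> (\<integral>y. (f y)\<^sup>2 \<partial>\<nu>) / real n" using v n by (simp add: divide_right_mono)
  finally show "(\<integral>x. (sample_mean n f x - (\<integral>y. f y \<partial>\<nu>))\<^sup>2 \<partial>?P) \<le> (\<integral>y. (f y)\<^sup>2 \<partial>\<nu>) / real n"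
    by (simp add: \<mu>_def)
qed

section \<open>The truncated series estimator\<close>

text \<open>
  The Hilbert space need not be separable, so measurability of vector valued maps is avoided:
  the squared norm is a polynomial in the real coefficients.
\<close>

lemma borel_measurable_norm_affine:
  fixes w :: "'h::real_inner"
  assumes c[measurable]: "\<And>i. i \<in> I \<Longrightarrow> c i \<in> borel_measurable M"
  shows "(\<lambda>x. norm (w - (\<Sum>i\<in>I. c i x *\<^sub>R u i))) \<in> borel_measurable M"
  unfolding norm_eq_sqrt_inner inner_diff_left inner_diff_right inner_sum_left inner_sum_right
    inner_scaleR_left inner_scaleR_right
  by measurable

text \<open>
  The coefficients are estimated with \<open>\<psi>\<close>, while the signed measure is built from the functions
  \<open>\<phi>\<close>, which stand for integrable approximations of \<open>\<psi>\<close>.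
\<close>

definition series_estimator ::
  "'a measure \<Rightarrow> (nat \<Rightarrow> 'a \<Rightarrow> real) \<Rightarrow> (nat \<Rightarrow> 'a \<Rightarrow> real) \<Rightarrow> nat \<Rightarrow> nat \<Rightarrow> (nat \<Rightarrow> 'a) \<Rightarrow> 'a set \<Rightarrow> real" where
  "series_estimator M \<psi> \<phi> m n x B = (\<Sum>i<m. sample_mean n (\<psi> i) x * (\<integral>y. indicator B y * \<phi> i y \<partial>M))"

lemma series_estimator_density:
  assumes \<phi>: "\<And>i. integrable M (\<phi> i)" and B: "B \<in> sets M"
  shows "series_estimator M \<psi> \<phi> m n x B =
    (\<integral>y. indicator B y * (\<Sum>i<m. sample_mean n (\<psi> i) x * \<phi> i y) \<partial>M)"
proof -
  have "integrable M (\<lambda>y. indicator B y * \<phi> i y)" for i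
    using integrable_mult_indicator[OF B \<phi>] by simp
  then show ?thesis
    unfolding series_estimator_def sum_distrib_left mult.left_commute[of "indicator B _"] by simp
qed

lemma signed_estimator_series_estimator:
  assumes \<phi>: "\<And>i. integrable M (\<phi> i)" and \<psi>: "\<And>i. \<psi> i \<in> borel_measurable M"
  shows "signed_estimator M n (series_estimator M \<psi> \<phi> m n)"
  unfolding signed_estimator_def
proof (intro conjI ballI)
  show "finite_signed_measure M (series_estimator M \<psi> \<phi> m n x)" for x
    by (rule finite_signed_measure_density[where g = "\<lambda>y. \<Sum>i<m. sample_mean n (\<psi> i) x * \<phi> i y"])
       (auto simp: \<phi> series_estimator_density)
  show "(\<lambda>x. series_estimator M \<psi> \<phi> m n x B) \<in> borel_measurable (Pi\<^sub>M {..<n} (\<lambda>_. M))" for B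
    unfolding series_estimator_def
    by (intro borel_measurable_sum borel_measurable_times sample_mean_measurable \<psi> borel_measurable_const)
qed

definition real_RN_deriv :: "'a measure \<Rightarrow> 'a measure \<Rightarrow> 'a \<Rightarrow> real" where
  "real_RN_deriv M \<nu> = (\<lambda>x. enn2real (RN_deriv M \<nu> x))"

lemma density_real_RN_deriv:
  assumes "sigma_finite_measure M" and \<nu>: "prob_space \<nu>" and s: "sets \<nu> = sets M"
    and ac: "absolutely_continuous M \<nu>"
  shows "integrable M (real_RN_deriv M \<nu>)"
    and "B \<in> sets M \<Longrightarrow> measure \<nu> B = (\<integral>x. indicator B x * real_RN_deriv M \<nu> x \<partial>M)"
    and "f \<in> borel_measurable M \<Longrightarrow> (\<integral>x. f x \<partial>\<nu>) = (\<integral>x. real_RN_deriv M \<nu> x * f x \<partial>M)"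
proof -
  interpret sigma_finite_measure M by fact
  interpret \<nu>: prob_space \<nu> by fact
  have sf: "sigma_finite_measure \<nu>" by unfold_locales
  show int: "(\<integral>x. f x \<partial>\<nu>) = (\<integral>x. real_RN_deriv M \<nu> x * f x \<partial>M)" if "f \<in> borel_measurable M" for f :: "'a \<Rightarrow> real"
    unfolding real_RN_deriv_def by (rule RN_deriv_integral[OF sf ac s that])
  show "integrable M (real_RN_deriv M \<nu>)"
    using RN_deriv_integrable[OF sf ac s, of "\<lambda>_. 1"] by (simp add: real_RN_deriv_def)
  show "measure \<nu> B = (\<integral>x. indicator B x * real_RN_deriv M \<nu> x \<partial>M)" if B: "B \<in> sets M" for B
  proof -
    have "measure \<nu> B = (\<integral>x. indicator B x \<partial>\<nu>)"
      using B s sets_eq_imp_space_eq[OF s] by (simp add: sets.Int_space_eq2)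
    then show ?thesis using int[of "indicator B"] B by (simp add: mult.commute)
  qed
qed

context mercer_rkhs
begin

lemma adj_approx_integrable:
  assumes "sigma_finite_measure M" "0 < d"
  shows "\<exists>\<phi>. square_integrable M \<phi> \<and> integrable M \<phi> \<and> norm (adj (\<psi> i) - adj \<phi>) \<le> d"
proof -
  obtain B where B: "B > 0" "\<And>f. square_integrable M f \<Longrightarrow> (norm (adj f))\<^sup>2 \<le> B * (\<integral>x. (f x)\<^sup>2 \<partial>M)"
    using norm_adj_bound by blast
  obtain \<phi> where \<phi>: "square_integrable M \<phi>" "integrable M \<phi>" "(\<integral>x. (\<psi> i x - \<phi> x)\<^sup>2 \<partial>M) < d\<^sup>2 / B"
    using L2_approx_integrable[OF assms(1) square_integrable_\<psi>, of "d\<^sup>2 / B"] B(1) assms(2) by auto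
  have "(norm (adj (\<psi> i) - adj \<phi>))\<^sup>2 \<le> B * (\<integral>x. (\<psi> i x - \<phi> x)\<^sup>2 \<partial>M)"
    using B(2)[OF square_integrable_diff[OF square_integrable_\<psi> \<phi>(1)]]
    by (simp add: adj_diff square_integrable_\<psi> \<phi>(1))
  also have "\<dots> \<le> d\<^sup>2" using \<phi>(3) B(1) by (simp add: pos_less_divide_eq mult.commute less_imp_le)
  finally show ?thesis using \<phi> assms(2) by (auto intro: power2_le_imp_le)
qed

text \<open>
  For \<open>i \<ge> m\<close> the bound \<open>t i \<le> t m\<close> gives \<open>t i \<le> t m powr (l + 1) * t i powr (- l)\<close>, which turns
  the tail into the quantity controlled by smoothness.
\<close>

lemma adj_truncation_bound:
  assumes q: "square_integrable M q" and "0 < l"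
    and smooth: "\<And>N. (\<Sum>i<N. t i powr (- l) * (L2_coeff M \<psi> q i)\<^sup>2) \<le> R"
  shows "(norm (adj q - (\<Sum>j<m. a j *\<^sub>R adj (\<psi> j))))\<^sup>2
    \<le> (\<Sum>j<m. t j * (a j - L2_coeff M \<psi> q j)\<^sup>2) + t m powr (l + 1) * R"
proof -
  define b where "b = L2_coeff M \<psi> q"
  define f where "f x = q x - (\<Sum>j<m. a j * \<psi> j x)" for x
  have sum: "square_integrable M (\<lambda>x. \<Sum>j<m. a j * \<psi> j x)"
    by (intro square_integrable_sum square_integrable_scale square_integrable_\<psi>)
  have f: "square_integrable M f" unfolding f_def by (intro square_integrable_diff q sum)
  have "L2_coeff M \<psi> f i = b i - (if i < m then a i else 0)" for i
    unfolding f_def L2_coeff_diff[OF q sum] by (simp add: L2_coeff_lincomb b_def)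
  then have coeff: "t i * (L2_coeff M \<psi> f i)\<^sup>2 = t i * (b i - (if i < m then a i else 0))\<^sup>2" for i
    by simp
  have term_le: "t i * (L2_coeff M \<psi> f i)\<^sup>2
      \<le> (if i \<in> {..<m} then t i * (a i - b i)\<^sup>2 else 0) + t m powr (l + 1) * (t i powr (- l) * (b i)\<^sup>2)" for i
  proof (cases "i < m")
    case True
    then show ?thesis by (simp add: coeff power2_commute)
  next
    case False
    have "t i = t i powr (l + 1) * t i powr (- l)"
      using t_pos[of i] by (simp flip: powr_add)
    also have "\<dots> \<le> t m powr (l + 1) * t i powr (- l)"
      using antimonoD[OF antimono_t, of m i] False t_pos[of i] \<open>0 < l\<close>
      by (intro mult_right_mono powr_mono2) auto
    finally have "t i * (b i)\<^sup>2 \<le> t m powr (l + 1) * t i powr (- l) * (b i)\<^sup>2"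
      by (rule mult_right_mono) simp
    then show ?thesis using False by (simp add: coeff mult.assoc)
  qed
  have "(norm (adj f))\<^sup>2 \<le> (\<Sum>j<m. t j * (a j - b j)\<^sup>2) + t m powr (l + 1) * R"
  proof (rule LIMSEQ_le_const2[OF norm_adj_sums[OF f, unfolded sums_def]], intro exI allI impI)
    fix N
    have "(\<Sum>i<N. t i * (L2_coeff M \<psi> f i)\<^sup>2)
        \<le> (\<Sum>i<N. if i \<in> {..<m} then t i * (a i - b i)\<^sup>2 else 0)
          + t m powr (l + 1) * (\<Sum>i<N. t i powr (- l) * (b i)\<^sup>2)"
      unfolding sum_distrib_left sum.distrib[symmetric] by (intro sum_mono term_le)
    also have "(\<Sum>i<N. if i \<in> {..<m} then t i * (a i - b i)\<^sup>2 else 0) \<le> (\<Sum>j<m. t j * (a j - b j)\<^sup>2)"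
      by (subst sum.inter_restrict[symmetric], simp,
          intro sum_mono2 mult_nonneg_nonneg zero_le_power2 less_imp_le[OF t_pos]) auto
    also have "t m powr (l + 1) * (\<Sum>i<N. t i powr (- l) * (b i)\<^sup>2) \<le> t m powr (l + 1) * R"
      unfolding b_def by (intro mult_left_mono smooth) simp
    finally show "(\<Sum>i<N. t i * (L2_coeff M \<psi> f i)\<^sup>2) \<le> (\<Sum>j<m. t j * (a j - b j)\<^sup>2) + t m powr (l + 1) * R"
      by simp
  qed
  moreover have "adj f = adj q - (\<Sum>j<m. a j *\<^sub>R adj (\<psi> j))"
    unfolding f_def[abs_def] by (simp add: adj_diff q sum adj_lincomb square_integrable_\<psi>)
  ultimately show ?thesis by (simp add: b_def)
qed

text \<open>
  If \<open>h\<close> represents the power \<open>- (l - 1) / 2\<close> of the operator applied to the density, its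
  coefficients are \<open>t i powr (- (l - 1) / 2)\<close> times those of the density. Squaring and dividing
  by \<open>t i\<close>, as Bessel's inequality asks, leaves the weight \<open>t i powr (- l)\<close>.
\<close>

lemma target_class_density:
  assumes M: "sigma_finite_measure M" and \<nu>: "\<nu> \<in> target_class M fn t \<psi> l r"
  shows "integrable M (real_RN_deriv M \<nu>)" "square_integrable M (real_RN_deriv M \<nu>)"
    and "\<And>B. B \<in> sets M \<Longrightarrow> measure \<nu> B = (\<integral>x. indicator B x * real_RN_deriv M \<nu> x \<partial>M)"
    and "\<And>i. L2_coeff M \<psi> (real_RN_deriv M \<nu>) i = (\<integral>x. \<psi> i x \<partial>\<nu>)"
    and "\<And>N. (\<Sum>i<N. t i powr (- l) * (L2_coeff M \<psi> (real_RN_deriv M \<nu>) i)\<^sup>2) \<le> r\<^sup>2"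
proof -
  let ?q = "real_RN_deriv M \<nu>"
  from \<nu> obtain h where prob: "prob_space \<nu>" and s: "sets \<nu> = sets M" and ac: "absolutely_continuous M \<nu>"
    and h: "is_op_power M t \<psi> (- (l - 1) / 2) ?q (fn h)" "norm h \<le> r"
    by (auto simp: target_class_def real_RN_deriv_def)
  note density = density_real_RN_deriv[OF M prob s ac]
  have q: "square_integrable M ?q"
    using h by (simp add: is_op_power_def L2_sums_def)
  have coeff: "L2_coeff M \<psi> (fn h) i = t i powr (- (l - 1) / 2) * L2_coeff M \<psi> ?q i" for i
    using h by (intro L2_sums_coeff[OF _ square_integrable_\<psi> orthonormal]) (simp add: is_op_power_def)
  show "(\<Sum>i<N. t i powr (- l) * (L2_coeff M \<psi> ?q i)\<^sup>2) \<le> r\<^sup>2" for N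
  proof -
    have "t i powr (- l) * (L2_coeff M \<psi> ?q i)\<^sup>2 = (L2_coeff M \<psi> (fn h) i)\<^sup>2 / t i" for i
    proof -
      have "(t i powr (- (l - 1) / 2))\<^sup>2 / t i = t i powr (- (l - 1) / 2 + - (l - 1) / 2) / t i powr 1"
        using t_pos[of i] by (simp only: power2_eq_square powr_add) simp
      also have "\<dots> = t i powr (- (l - 1) / 2 + - (l - 1) / 2 - 1)"
        by (simp only: powr_diff)
      also have "- (l - 1) / 2 + - (l - 1) / 2 - 1 = - l" by (simp add: field_simps)
      finally have "(t i powr (- (l - 1) / 2))\<^sup>2 / t i = t i powr (- l)" .
      then show ?thesis
        by (simp only: coeff power_mult_distrib times_divide_eq_left[symmetric])
    qed
    then have "(\<Sum>i<N. t i powr (- l) * (L2_coeff M \<psi> ?q i)\<^sup>2) \<le> (norm h)\<^sup>2"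
      using Bessel_rkhs[of h N] by simp
    also have "\<dots> \<le> r\<^sup>2" using h(2) by (intro power_mono) auto
    finally show ?thesis .
  qed
  show "L2_coeff M \<psi> ?q i = (\<integral>x. \<psi> i x \<partial>\<nu>)" for i
    using density(3)[of "\<psi> i"] square_integrable_measurable[OF square_integrable_\<psi>] by (simp add: L2_coeff_def)
  show "integrable M ?q" by (rule density(1))
  show "square_integrable M ?q" by (rule q)
  show "measure \<nu> B = (\<integral>x. indicator B x * ?q x \<partial>M)" if "B \<in> sets M" for B
    by (rule density(2)[OF that])
qed

lemma ipm_series_estimator:
  assumes q: "integrable M q" "square_integrable M q"
    and \<nu>: "\<And>B. B \<in> sets M \<Longrightarrow> measure \<nu> B = (\<integral>x. indicator B x * q x \<partial>M)"
    and \<phi>: "\<And>i. square_integrable M (\<phi> i)" "\<And>i. integrable M (\<phi> i)"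
  shows "ipm M (rkhs_ball fn) (measure \<nu>) (series_estimator M \<psi> \<phi> m n x)
    = ereal (norm (adj q - (\<Sum>i<m. sample_mean n (\<psi> i) x *\<^sub>R adj (\<phi> i))))"
proof -
  define p where "p y = (\<Sum>i<m. sample_mean n (\<psi> i) x * \<phi> i y)" for y
  have p: "integrable M p" "square_integrable M p"
    unfolding p_def[abs_def] by (auto intro!: \<phi> square_integrable_sum square_integrable_scale)
  have "measure \<nu> B - series_estimator M \<psi> \<phi> m n x B = (\<integral>y. indicator B y * (q y - p y) \<partial>M)"
    if B: "B \<in> sets M" for B
    using integrable_mult_indicator[OF B q(1)] integrable_mult_indicator[OF B p(1)]
    by (simp add: \<nu>[OF B] series_estimator_density[OF \<phi>(2) B] p_def[symmetric] right_diff_distrib)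
  then have "ipm M (rkhs_ball fn) (measure \<nu>) (series_estimator M \<psi> \<phi> m n x) = ereal (norm (adj (\<lambda>y. q y - p y)))"
    using p q by (intro ipm_rkhs_ball square_integrable_diff) auto
  also have "adj (\<lambda>y. q y - p y) = adj q - (\<Sum>i<m. sample_mean n (\<psi> i) x *\<^sub>R adj (\<phi> i))"
    using adj_diff[OF q(2) p(2)] by (simp add: p_def[abs_def] adj_lincomb \<phi>(1))
  finally show ?thesis .
qed

text \<open>
  A pointwise bound that is linear in the squared errors \<open>(c j - b j)\<^sup>2\<close>, so that only their
  expectations are needed afterwards. It uses \<open>sqrt X \<le> a + X / a\<close>; the parameter \<open>a\<close> will be
  the target rate. The last summand is the price of replacing \<open>\<psi>\<close> by \<open>\<phi>\<close>, with \<open>\<bar>c j\<bar>\<close> bounded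
  through \<open>\<bar>y\<bar> \<le> y\<^sup>2 + 1\<close>.
\<close>

lemma series_estimator_loss_le:
  assumes q: "square_integrable M q" and "0 < l" "0 < a" "0 \<le> r" "0 \<le> d"
    and smooth: "\<And>N. (\<Sum>i<N. t i powr (- l) * (L2_coeff M \<psi> q i)\<^sup>2) \<le> r\<^sup>2"
    and \<phi>: "\<And>i. norm (adj (\<psi> i) - adj (\<phi> i)) \<le> d"
  defines "b \<equiv> L2_coeff M \<psi> q"
  shows "norm (adj q - (\<Sum>i<m. c i *\<^sub>R adj (\<phi> i)))
    \<le> a + (\<Sum>j<m. t j * (c j - b j)\<^sup>2) / a + t m powr ((l + 1) / 2) * r
      + d * (\<Sum>j<m. (c j - b j)\<^sup>2 + 2 + (b j)\<^sup>2)"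
proof -
  define X where "X = (\<Sum>j<m. t j * (c j - b j)\<^sup>2)"
  define \<beta> where "\<beta> = t m powr ((l + 1) / 2) * r"
  have "0 \<le> X" unfolding X_def by (intro sum_nonneg mult_nonneg_nonneg zero_le_power2 less_imp_le[OF t_pos])
  have "0 \<le> \<beta>" using assms by (simp add: \<beta>_def)
  have \<beta>2: "\<beta>\<^sup>2 = t m powr (l + 1) * r\<^sup>2"
    unfolding \<beta>_def power_mult_distrib by (simp add: power2_eq_square flip: powr_add)
  have "(norm (adj q - (\<Sum>i<m. c i *\<^sub>R adj (\<psi> i))))\<^sup>2 \<le> X + \<beta>\<^sup>2"
    using adj_truncation_bound[OF q \<open>0 < l\<close> smooth, where m = m and a = c]
    unfolding X_def b_def \<beta>2 .
  also have "\<dots> \<le> (sqrt X + \<beta>)\<^sup>2"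
    using \<open>0 \<le> X\<close> \<open>0 \<le> \<beta>\<close> by (simp add: power2_sum)
  finally have "norm (adj q - (\<Sum>i<m. c i *\<^sub>R adj (\<psi> i))) \<le> sqrt X + \<beta>"
    by (rule power2_le_imp_le) (intro add_nonneg_nonneg real_sqrt_ge_zero \<open>0 \<le> X\<close> \<open>0 \<le> \<beta>\<close>)
  also have "sqrt X \<le> a + X / a"
  proof -
    have "a * sqrt X \<le> a\<^sup>2 + X"
    proof -
      have "0 \<le> (a - sqrt X)\<^sup>2" by simp
      then have "2 * (a * sqrt X) \<le> a\<^sup>2 + X" using \<open>0 \<le> X\<close> by (simp add: power2_diff)
      moreover have "0 \<le> a * sqrt X" using \<open>0 \<le> X\<close> \<open>0 < a\<close> by simp
      ultimately show ?thesis by linarith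
    qed
    then show ?thesis using \<open>0 < a\<close> by (simp add: field_simps power2_eq_square)
  qed
  finally have main: "norm (adj q - (\<Sum>i<m. c i *\<^sub>R adj (\<psi> i))) \<le> a + X / a + \<beta>" by simp
  have "norm (\<Sum>i<m. c i *\<^sub>R (adj (\<psi> i) - adj (\<phi> i))) \<le> (\<Sum>i<m. ((c i - b i)\<^sup>2 + 2 + (b i)\<^sup>2) * d)"
  proof (intro sum_norm_le)
    fix i
    have "\<bar>y\<bar> \<le> y\<^sup>2 + 1" for y :: real
    proof -
      have "0 \<le> (\<bar>y\<bar> - 1)\<^sup>2" by simp
      then have "2 * \<bar>y\<bar> \<le> y\<^sup>2 + 1" by (simp add: power2_diff)
      then show ?thesis by linarith
    qed
    from this[of "c i - b i"] this[of "b i"]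
    have "\<bar>c i\<bar> \<le> (c i - b i)\<^sup>2 + 2 + (b i)\<^sup>2" by linarith
    then show "norm (c i *\<^sub>R (adj (\<psi> i) - adj (\<phi> i))) \<le> ((c i - b i)\<^sup>2 + 2 + (b i)\<^sup>2) * d"
      unfolding norm_scaleR by (intro mult_mono \<phi>) auto
  qed
  also have "\<dots> = d * (\<Sum>j<m. (c j - b j)\<^sup>2 + 2 + (b j)\<^sup>2)"
    by (simp add: sum_distrib_left mult.commute)
  finally have "norm (\<Sum>i<m. c i *\<^sub>R (adj (\<psi> i) - adj (\<phi> i))) \<le> d * (\<Sum>j<m. (c j - b j)\<^sup>2 + 2 + (b j)\<^sup>2)" .
  moreover have "adj q - (\<Sum>i<m. c i *\<^sub>R adj (\<phi> i))
      = (adj q - (\<Sum>i<m. c i *\<^sub>R adj (\<psi> i))) + (\<Sum>i<m. c i *\<^sub>R (adj (\<psi> i) - adj (\<phi> i)))"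
    by (simp add: scaleR_diff_right sum_subtractf)
  ultimately show ?thesis
    using main norm_triangle_ineq[of "adj q - (\<Sum>i<m. c i *\<^sub>R adj (\<psi> i))"] unfolding X_def \<beta>_def by smt
qed

lemma expected_loss_series_estimator:
  assumes M: "sigma_finite_measure M" and \<nu>: "\<nu> \<in> target_class M fn t \<psi> l r"
    and "0 < l" "0 < a" "0 \<le> r" "0 \<le> d" "0 < n" "0 \<le> C"
    and moment: "\<And>i. (\<integral>\<^sup>+x. ennreal ((\<psi> i x)\<^sup>2) \<partial>\<nu>) \<le> ennreal C"
    and \<phi>: "\<And>i. square_integrable M (\<phi> i)" "\<And>i. integrable M (\<phi> i)"
      "\<And>i. norm (adj (\<psi> i) - adj (\<phi> i)) \<le> d"
  shows "expected_loss M (rkhs_ball fn) n (series_estimator M \<psi> \<phi> m n) \<nu>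
    \<le> ennreal (a + C * (\<Sum>j<m. t j) / real n / a + t m powr ((l + 1) / 2) * r + d * real m * (2 + 2 * C))"
proof -
  define q where "q = real_RN_deriv M \<nu>"
  note q = target_class_density(1,2)[OF M \<nu>, folded q_def]
    and q\<nu> = target_class_density(3)[OF M \<nu>, folded q_def]
    and mean = target_class_density(4)[OF M \<nu>, folded q_def]
    and smooth = target_class_density(5)[OF M \<nu>, folded q_def]
  have prob: "prob_space \<nu>" and s: "sets \<nu> = sets M" using \<nu> by (auto simp: target_class_def)
  interpret \<nu>: prob_space \<nu> by fact
  let ?P = "Pi\<^sub>M {..<n} (\<lambda>_. \<nu>)"
  interpret P: prob_space ?P by (intro prob_space_PiM prob)
  define b where "b = L2_coeff M \<psi> q"
  define e where "e i x = (sample_mean n (\<psi> i) x - b i)\<^sup>2" for i x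
  have meas: "\<psi> i \<in> borel_measurable \<nu>" for i
    using square_integrable_measurable[OF square_integrable_\<psi>] s by (simp cong: measurable_cong_sets)
  have "integrable \<nu> (\<lambda>x. (\<psi> i x)\<^sup>2)" for i
    using meas[of i] moment[of i] by (intro integrableI_bounded) (auto intro: le_less_trans)
  then have \<psi>\<nu>: "square_integrable \<nu> (\<psi> i)" for i using meas by (simp add: square_integrable_def)
  have var: "(\<integral>x. (\<psi> i x)\<^sup>2 \<partial>\<nu>) \<le> C" for i
    using moment[of i] \<psi>\<nu>[of i] \<open>0 \<le> C\<close> by (simp add: nn_integral_eq_integral square_integrable_def)
  have e1: "integrable ?P (e i)" for i
    using sample_mean_mse(1)[OF prob \<psi>\<nu> \<open>0 < n\<close>] by (simp add: e_def[abs_def] b_def mean)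
  have e2: "(\<integral>x. e i x \<partial>?P) \<le> C / real n" for i
  proof -
    have "(\<integral>x. e i x \<partial>?P) \<le> (\<integral>x. (\<psi> i x)\<^sup>2 \<partial>\<nu>) / real n"
      using sample_mean_mse(2)[OF prob \<psi>\<nu> \<open>0 < n\<close>, of i] by (simp add: e_def b_def mean)
    also have "\<dots> \<le> C / real n" by (intro divide_right_mono var) simp
    finally show ?thesis .
  qed
  note e = e1 e2
  have b: "(b i)\<^sup>2 \<le> C" for i
  proof -
    have sq: "integrable \<nu> (\<lambda>x. (\<psi> i x)\<^sup>2)" using \<psi>\<nu>[of i] by (simp add: square_integrable_def)
    have "0 \<le> (\<integral>x. (\<psi> i x)\<^sup>2 \<partial>\<nu>) - (b i)\<^sup>2"
      using \<nu>.variance_positive[of "\<psi> i"]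
        \<nu>.variance_eq[OF \<nu>.square_integrable_imp_integrable[OF meas sq] sq]
      unfolding b_def mean by linarith
    then show ?thesis using var[of i] by linarith
  qed
  define U where "U x = a + (\<Sum>j<m. t j * e j x) / a + t m powr ((l + 1) / 2) * r
      + d * (\<Sum>j<m. e j x + 2 + (b j)\<^sup>2)" for x
  have "0 \<le> e i x" for i x by (simp add: e_def)
  then have U_nonneg: "0 \<le> U x" for x
    unfolding U_def
    by (intro add_nonneg_nonneg divide_nonneg_pos mult_nonneg_nonneg sum_nonneg zero_le_power2 powr_ge_zero
        less_imp_le[OF t_pos] less_imp_le[OF \<open>0 < a\<close>] \<open>0 < a\<close> \<open>0 \<le> r\<close> \<open>0 \<le> d\<close>) simp_all
  have intU: "integrable ?P U" unfolding U_def[abs_def] using e(1) by simp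
  have ipm_eq: "ipm M (rkhs_ball fn) (measure \<nu>) (series_estimator M \<psi> \<phi> m n x)
      = ereal (norm (adj q - (\<Sum>i<m. sample_mean n (\<psi> i) x *\<^sub>R adj (\<phi> i))))" for x
    by (rule ipm_series_estimator[OF q q\<nu> \<phi>(1,2)])
  have "expected_loss M (rkhs_ball fn) n (series_estimator M \<psi> \<phi> m n) \<nu> \<le> (\<integral>\<^sup>+x. ennreal (U x) \<partial>?P)"
    unfolding expected_loss_def ipm_eq e2ennreal_ereal
    using series_estimator_loss_le[OF q(2) \<open>0 < l\<close> \<open>0 < a\<close> \<open>0 \<le> r\<close> \<open>0 \<le> d\<close> smooth \<phi>(3)]
    unfolding U_def e_def b_def by (intro nn_integral_mono ennreal_leI)
  also have "\<dots> = ennreal (\<integral>x. U x \<partial>?P)"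
    by (intro nn_integral_eq_integral AE_I2 intU U_nonneg)
  also have "(\<integral>x. U x \<partial>?P) = a + (\<Sum>j<m. t j * (\<integral>x. e j x \<partial>?P)) / a + t m powr ((l + 1) / 2) * r
      + d * (\<Sum>j<m. (\<integral>x. e j x \<partial>?P) + 2 + (b j)\<^sup>2)"
    unfolding U_def[abs_def] using e(1) by (simp add: P.prob_space)
  also have "ennreal \<dots> \<le> ennreal (a + (\<Sum>j<m. t j * (C / real n)) / a + t m powr ((l + 1) / 2) * r
      + d * (\<Sum>j<m. C + 2 + C))"
  proof (intro ennreal_leI add_mono order_refl divide_right_mono mult_left_mono sum_mono e b)
    have "C / real n \<le> C / 1" using \<open>0 < n\<close> \<open>0 \<le> C\<close> by (intro divide_left_mono) auto
    then show "(\<integral>x. e i x \<partial>?P) \<le> C" for i using e(2)[of i] by simp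
  qed (use assms less_imp_le[OF t_pos] in auto)
  also have "a + (\<Sum>j<m. t j * (C / real n)) / a + t m powr ((l + 1) / 2) * r + d * (\<Sum>j<m. C + 2 + C)
      = a + C * (\<Sum>j<m. t j) / real n / a + t m powr ((l + 1) / 2) * r + d * real m * (2 + 2 * C)"
    by (simp only: sum_distrib_right[symmetric]) (simp add: algebra_simps)
  finally show ?thesis .
qed

lemma ipm_series_estimator_measurable:
  assumes M: "sigma_finite_measure M" and \<nu>: "\<nu> \<in> target_class M fn t \<psi> l r"
    and \<phi>: "\<And>i. square_integrable M (\<phi> i)" "\<And>i. integrable M (\<phi> i)"
  shows "(\<lambda>x. ipm M (rkhs_ball fn) (measure \<nu>) (series_estimator M \<psi> \<phi> m n x))
    \<in> borel_measurable (Pi\<^sub>M {..<n} (\<lambda>_. \<nu>))"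
proof -
  define q where "q = real_RN_deriv M \<nu>"
  note q = target_class_density(1,2)[OF M \<nu>, folded q_def]
    and q\<nu> = target_class_density(3)[OF M \<nu>, folded q_def]
    and mean = target_class_density(4)[OF M \<nu>, folded q_def]
    and smooth = target_class_density(5)[OF M \<nu>, folded q_def]
  have s: "sets \<nu> = sets M" using \<nu> by (auto simp: target_class_def)
  have "\<psi> i \<in> borel_measurable \<nu>" for i
    using square_integrable_measurable[OF square_integrable_\<psi>] s by (simp cong: measurable_cong_sets)
  then have "(\<lambda>x. norm (adj q - (\<Sum>i<m. sample_mean n (\<psi> i) x *\<^sub>R adj (\<phi> i)))) \<in> borel_measurable (Pi\<^sub>M {..<n} (\<lambda>_. \<nu>))"
    by (intro borel_measurable_norm_affine sample_mean_measurable)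
  moreover have ipm_eq: "ipm M (rkhs_ball fn) (measure \<nu>) (series_estimator M \<psi> \<phi> m n x)
      = ereal (norm (adj q - (\<Sum>i<m. sample_mean n (\<psi> i) x *\<^sub>R adj (\<phi> i))))" for x
    by (rule ipm_series_estimator[OF q q\<nu> \<phi>(1,2)])
  ultimately show ?thesis by simp
qed

end

section \<open>Balancing bias and variance\<close>

text \<open>
  Beyond the index where the decay bound holds, split off the summable factor \<open>j powr (- 1 - \<delta>)\<close>
  and bound the remaining power of \<open>j\<close> by the same power of \<open>m\<close>. This treats summable and
  non-summable eigenvalues alike.
\<close>

lemma sum_le_powr:
  fixes t :: "nat \<Rightarrow> real"
  assumes decay: "\<forall>\<^sub>F i in sequentially. t i \<le> real i powr (- \<kappa> + \<delta>)" and "0 < \<delta>"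
  shows "\<exists>D>0. \<forall>m\<ge>1. (\<Sum>j<m. t j) \<le> D * real m powr (max (1 - \<kappa>) 0 + 2 * \<delta>)"
proof -
  define \<rho> where "\<rho> = max (1 - \<kappa>) 0 + 2 * \<delta>"
  have "0 \<le> \<rho>" using \<open>0 < \<delta>\<close> by (simp add: \<rho>_def)
  obtain N where N: "\<And>i. i \<ge> N \<Longrightarrow> t i \<le> real i powr (- \<kappa> + \<delta>)" and "N \<ge> 1"
    using decay unfolding eventually_sequentially
    by (metis max.bounded_iff max.cobounded2)
  define S where "S = (\<Sum>j<N. \<bar>t j\<bar>)"
  define Z where "Z = (\<Sum>j. real j powr (- 1 - \<delta>))"
  have summ: "summable (\<lambda>j. real j powr (- 1 - \<delta>))"
    using \<open>0 < \<delta>\<close> by (simp add: summable_real_powr_iff)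
  have "0 \<le> S" by (simp add: S_def sum_nonneg)
  have "0 \<le> Z" unfolding Z_def by (intro suminf_nonneg summ) simp
  have "(\<Sum>j<m. t j) \<le> (S + Z + 1) * real m powr \<rho>" if "m \<ge> 1" for m
  proof -
    have m: "1 \<le> real m powr \<rho>" using that \<open>0 \<le> \<rho>\<close> by (intro ge_one_powr_ge_zero) auto
    have "t j \<le> (if j < N then \<bar>t j\<bar> else 0) + real j powr (- 1 - \<delta>) * real m powr \<rho>" if "j < m" for j
    proof (cases "j < N")
      case False
      then have j: "1 \<le> real j" using \<open>N \<ge> 1\<close> by simp
      have "t j \<le> real j powr (- \<kappa> + \<delta>)" using N False by simp
      also have "\<dots> \<le> real j powr (- 1 - \<delta> + \<rho>)"
        using j by (intro powr_mono) (auto simp: \<rho>_def)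
      also have "\<dots> = real j powr (- 1 - \<delta>) * real j powr \<rho>" by (rule powr_add)
      also have "\<dots> \<le> real j powr (- 1 - \<delta>) * real m powr \<rho>"
        using that \<open>0 \<le> \<rho>\<close> by (intro mult_left_mono powr_mono2) auto
      finally show ?thesis using False by simp
    qed (simp add: add_increasing2)
    then have "(\<Sum>j<m. t j) \<le> (\<Sum>j<m. (if j \<in> {..<N} then \<bar>t j\<bar> else 0) + real j powr (- 1 - \<delta>) * real m powr \<rho>)"
      by (intro sum_mono) auto
    also have "\<dots> = (\<Sum>j\<in>{..<m} \<inter> {..<N}. \<bar>t j\<bar>) + (\<Sum>j<m. real j powr (- 1 - \<delta>)) * real m powr \<rho>"
      by (simp add: sum.distrib sum.inter_restrict sum_distrib_right)
    also have "\<dots> \<le> S * real m powr \<rho> + Z * real m powr \<rho>"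
    proof (intro add_mono mult_right_mono)
      have "(\<Sum>j\<in>{..<m} \<inter> {..<N}. \<bar>t j\<bar>) \<le> S" unfolding S_def by (intro sum_mono2) auto
      also have "\<dots> = S * 1" by simp
      also have "\<dots> \<le> S * real m powr \<rho>" using m \<open>0 \<le> S\<close> by (rule mult_left_mono)
      finally show "(\<Sum>j\<in>{..<m} \<inter> {..<N}. \<bar>t j\<bar>) \<le> S * real m powr \<rho>" .
      show "(\<Sum>j<m. real j powr (- 1 - \<delta>)) \<le> Z"
        unfolding Z_def by (intro sum_le_suminf summ) auto
    qed simp
    also have "\<dots> \<le> (S + Z + 1) * real m powr \<rho>" by (simp add: distrib_right)
    finally show ?thesis .
  qed
  moreover have "0 < S + Z + 1" using \<open>0 \<le> S\<close> \<open>0 \<le> Z\<close> by simp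
  ultimately show ?thesis unfolding \<rho>_def by blast
qed

definition cutoff :: "real \<Rightarrow> nat \<Rightarrow> nat" where
  "cutoff \<gamma> n = nat \<lceil>real n powr \<gamma>\<rceil>"

lemma cutoff_bounds:
  assumes "0 < \<gamma>" "1 \<le> n"
  shows "real n powr \<gamma> \<le> real (cutoff \<gamma> n)" "real (cutoff \<gamma> n) \<le> 2 * real n powr \<gamma>" "1 \<le> cutoff \<gamma> n"
proof -
  have "1 \<le> real n powr \<gamma>" using assms by (intro ge_one_powr_ge_zero) auto
  then show "real n powr \<gamma> \<le> real (cutoff \<gamma> n)" "real (cutoff \<gamma> n) \<le> 2 * real n powr \<gamma>" "1 \<le> cutoff \<gamma> n"
    unfolding cutoff_def by linarith+
qed

lemma filterlim_cutoff:
  assumes "0 < \<gamma>"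
  shows "filterlim (cutoff \<gamma>) at_top sequentially"
proof -
  have "filterlim (\<lambda>n. exp (\<gamma> * ln (real n))) at_top sequentially"
    by (intro filterlim_compose[OF exp_at_top] filterlim_tendsto_pos_mult_at_top[OF tendsto_const assms]
        filterlim_compose[OF ln_at_top filterlim_real_sequentially])
  moreover have "\<forall>\<^sub>F n in sequentially. exp (\<gamma> * ln (real n)) = real n powr \<gamma>"
    using eventually_ge_at_top[of 1] by eventually_elim (simp add: powr_def)
  ultimately have "filterlim (\<lambda>n. real n powr \<gamma>) at_top sequentially"
    by (rule filterlim_mono_eventually[OF _ order_refl order_refl])
  then have "filterlim (\<lambda>n. real (cutoff \<gamma> n)) at_top sequentially"
    by (rule filterlim_at_top_mono)
       (rule eventually_sequentiallyI[of 1], rule cutoff_bounds(1)[OF assms])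
  then show ?thesis by (simp add: filterlim_sequentially_iff_filterlim_real)
qed

text \<open>
  The cutoff exponent \<open>\<gamma>\<close> equates squared bias \<open>m powr (- \<kappa> (l + 1))\<close> and variance
  \<open>m powr (1 - \<kappa>) / n\<close> when \<open>\<kappa> \<le> 1\<close>. For larger \<open>\<kappa>\<close> the variance is \<open>1 / n\<close> up to small powers,
  and the same cutoff still makes the bias small enough.
\<close>

lemma variance_bias_rate:
  fixes t :: "nat \<Rightarrow> real" and \<kappa> l :: real
  assumes "0 < \<kappa>" "0 < l" and pos: "\<And>i. 0 < t i"
    and decay: "\<And>\<delta>. 0 < \<delta> \<Longrightarrow> \<forall>\<^sub>F i in sequentially. t i \<le> real i powr (- \<kappa> + \<delta>)"
    and "0 < e"
  defines "\<gamma> \<equiv> 1 / (l * \<kappa> + 1)"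
    and "s \<equiv> max (- ((l + 1) * \<kappa> / (2 * l * \<kappa> + 2))) (- (1 / 2))"
  shows "\<forall>\<^sub>F n in sequentially. t (cutoff \<gamma> n) powr ((l + 1) / 2) \<le> real n powr (s + e)"
    and "\<exists>D>0. \<forall>\<^sub>F n in sequentially. (\<Sum>j<cutoff \<gamma> n. t j) / real n \<le> D * real n powr (2 * (s + e))"
proof -
  have lk: "0 < l * \<kappa>" using assms by simp
  then have \<gamma>: "0 < \<gamma>" "\<gamma> \<le> 1" by (simp_all add: \<gamma>_def)
  have s1: "- \<gamma> * \<kappa> * (l + 1) / 2 \<le> s"
  proof -
    have "- \<gamma> * \<kappa> * (l + 1) / 2 = - ((l + 1) * \<kappa> / (2 * l * \<kappa> + 2))"
      using lk by (simp add: \<gamma>_def field_simps)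
    then show ?thesis unfolding s_def by linarith
  qed
  have s2: "\<gamma> * max (1 - \<kappa>) 0 - 1 \<le> 2 * s"
  proof (cases "\<kappa> \<le> 1")
    case True
    have "\<gamma> * (1 - \<kappa>) - 1 = 2 * (- \<gamma> * \<kappa> * (l + 1) / 2)"
      using lk by (simp add: \<gamma>_def field_simps)
    then show ?thesis using s1 True by simp
  next
    case False
    then show ?thesis by (simp add: s_def)
  qed
  show "\<forall>\<^sub>F n in sequentially. t (cutoff \<gamma> n) powr ((l + 1) / 2) \<le> real n powr (s + e)"
  proof -
    \<comment> \<open>\<open>\<delta> < \<kappa>\<close> keeps the exponent of the cutoff negative, so that its lower bound can be used;
      the other term keeps the loss in the exponent below \<open>e\<close>.\<close>
    define \<delta> where "\<delta> = min (\<kappa> / 2) (e / (l + 1))"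
    have "\<delta> * (l + 1) \<le> e / (l + 1) * (l + 1)"
      using assms(2) by (intro mult_right_mono) (auto simp: \<delta>_def)
    then have \<delta>: "0 < \<delta>" "\<delta> < \<kappa>" "\<delta> * (l + 1) \<le> e"
      using assms(1,2,5) by (auto simp: \<delta>_def)
    have "\<forall>\<^sub>F n in sequentially. t (cutoff \<gamma> n) \<le> real (cutoff \<gamma> n) powr (- \<kappa> + \<delta>)"
      using decay[OF \<delta>(1)] filterlim_cutoff[OF \<gamma>(1)] by (rule eventually_compose_filterlim)
    then show ?thesis
      using eventually_ge_at_top[of 1]
    proof eventually_elim
      case (elim n)
      note cut = cutoff_bounds[OF \<gamma>(1) elim(2)]
      have "real (cutoff \<gamma> n) powr (- \<kappa> + \<delta>) \<le> (real n powr \<gamma>) powr (- \<kappa> + \<delta>)"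
        using cut \<delta> elim(2) by (intro powr_mono2') auto
      with elim(1) have "t (cutoff \<gamma> n) \<le> real n powr (\<gamma> * (- \<kappa> + \<delta>))"
        by (simp add: powr_powr)
      then have "t (cutoff \<gamma> n) powr ((l + 1) / 2) \<le> (real n powr (\<gamma> * (- \<kappa> + \<delta>))) powr ((l + 1) / 2)"
        using pos less_imp_le \<open>0 < l\<close> by (intro powr_mono2) auto
      also have "\<dots> = real n powr (\<gamma> * (- \<kappa> + \<delta>) * ((l + 1) / 2))" by (rule powr_powr)
      also have "\<dots> \<le> real n powr (s + e)"
      proof (rule powr_mono)
        have "\<gamma> * (\<delta> * (l + 1)) \<le> 1 * e"
          using \<gamma> \<delta> \<open>0 < l\<close> by (intro mult_mono) auto
        moreover have "\<gamma> * (- \<kappa> + \<delta>) * ((l + 1) / 2) = - \<gamma> * \<kappa> * (l + 1) / 2 + \<gamma> * (\<delta> * (l + 1)) / 2"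
          by (simp add: field_simps)
        ultimately show "\<gamma> * (- \<kappa> + \<delta>) * ((l + 1) / 2) \<le> s + e" using s1 \<open>0 < e\<close> by linarith
      qed (use elim(2) in simp)
      finally show ?case .
    qed
  qed
  show "\<exists>D>0. \<forall>\<^sub>F n in sequentially. (\<Sum>j<cutoff \<gamma> n. t j) / real n \<le> D * real n powr (2 * (s + e))"
  proof -
    define \<rho> where "\<rho> = max (1 - \<kappa>) 0 + 2 * e"
    have "0 \<le> \<rho>" using \<open>0 < e\<close> by (simp add: \<rho>_def)
    obtain D where D: "D > 0" "\<And>m. m \<ge> 1 \<Longrightarrow> (\<Sum>j<m. t j) \<le> D * real m powr \<rho>"
      using sum_le_powr[OF decay[OF \<open>0 < e\<close>] \<open>0 < e\<close>] unfolding \<rho>_def by blast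
    have "(\<Sum>j<cutoff \<gamma> n. t j) / real n \<le> D * 2 powr \<rho> * real n powr (2 * (s + e))" if n: "1 \<le> n" for n
    proof -
      note cut = cutoff_bounds[OF \<gamma>(1) n]
      have "(\<Sum>j<cutoff \<gamma> n. t j) \<le> D * real (cutoff \<gamma> n) powr \<rho>" by (rule D(2)[OF cut(3)])
      also have "\<dots> \<le> D * (2 * real n powr \<gamma>) powr \<rho>"
        using cut D(1) \<open>0 \<le> \<rho>\<close> by (intro mult_left_mono powr_mono2) auto
      also have "\<dots> = D * 2 powr \<rho> * real n powr (\<gamma> * \<rho>)"
        by (simp add: powr_mult powr_powr)
      finally have "(\<Sum>j<cutoff \<gamma> n. t j) / real n \<le> D * 2 powr \<rho> * (real n powr (\<gamma> * \<rho>) / real n powr 1)"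
        using n by (simp add: divide_right_mono)
      also have "real n powr (\<gamma> * \<rho>) / real n powr 1 = real n powr (\<gamma> * \<rho> - 1)"
        by (rule powr_diff[symmetric])
      also have "D * 2 powr \<rho> * \<dots> \<le> D * 2 powr \<rho> * real n powr (2 * (s + e))"
      proof (intro mult_left_mono powr_mono)
        have "\<gamma> * e \<le> 1 * e" using \<gamma> \<open>0 < e\<close> by (intro mult_right_mono) auto
        then have "(\<gamma> * max (1 - \<kappa>) 0 - 1) + 2 * (\<gamma> * e) \<le> 2 * s + 2 * e"
          by (intro add_mono s2) simp
        then show "\<gamma> * \<rho> - 1 \<le> 2 * (s + e)" by (simp add: \<rho>_def distrib_left)
      qed (use n D(1) in auto)
      finally show ?thesis .
    qed
    then show ?thesis
      using D(1) by (intro exI[of _ "D * 2 powr \<rho>"]) (auto intro: eventually_sequentiallyI[of 1])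
  qed
qed

section \<open>The rate of the truncated series estimator\<close>

theorem theorem7:
  fixes \<pi> :: "'a measure"
    and K :: "'a \<Rightarrow> 'a \<Rightarrow> real"
    and fn :: "'h::{real_inner, complete_space} \<Rightarrow> 'a \<Rightarrow> real"
    and t :: "nat \<Rightarrow> real"
    and \<psi> :: "nat \<Rightarrow> 'a \<Rightarrow> real"
    and \<kappa> l r C :: real
  defines "F \<equiv> rkhs_ball fn"
    and "G \<equiv> target_class \<pi> fn t \<psi> l r"
  assumes "sigma_finite_measure \<pi>"
    and "psd_kernel (space \<pi>) K"
    and "rkhs (space \<pi>) K fn"
    and "\<And>h. square_integrable \<pi> (fn h)"
    and "mercer_system \<pi> K t \<psi>"
    and "\<kappa> > 0" and "asymp_pow (\<lambda>i. ennreal (t i)) (- \<kappa>)"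
    and "l > 0" and "r > 0"
    and "(SUP \<nu>\<in>G. SUP i. \<integral>\<^sup>+x. ennreal ((\<psi> i x)\<^sup>2) \<partial>\<nu>) \<le> ennreal C"
  shows "\<exists>T. (\<forall>n. signed_estimator \<pi> n (T n)) \<and>
             (\<forall>n. \<forall>\<nu>\<in>G. (\<lambda>x. ipm \<pi> F (measure \<nu>) (T n x))
                 \<in> borel_measurable (Pi\<^sub>M {..<n} (\<lambda>_. \<nu>))) \<and>
             precsim_pow (\<lambda>n. SUP \<nu>\<in>G. expected_loss \<pi> F n (T n) \<nu>)
               (max (- ((l + 1) * \<kappa> / (2 * l * \<kappa> + 2))) (- (1 / 2)))"
proof -
  \<comment> \<open>\<open>ennreal C\<close> is \<open>0\<close> for negative \<open>C\<close>, so \<open>C'\<close> is a bound for the moments in every case.\<close>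
  define C' where "C' = max C 0"
  define \<gamma> where "\<gamma> = 1 / (l * \<kappa> + 1)"
  define s where "s = max (- ((l + 1) * \<kappa> / (2 * l * \<kappa> + 2))) (- (1 / 2))"
  \<comment> \<open>\<open>cutoff\<close> many coefficients are exchanged, each at a cost of order \<open>d n\<close>; the total must
    stay below \<open>1 / n\<close>, which is faster than the rate.\<close>
  define d where "d n = 1 / (real (cutoff \<gamma> n + 1) * real (n + 1))" for n
  have asymp: "precsim_pow (\<lambda>i. ennreal (t i)) (- \<kappa>)" "succsim_pow (\<lambda>i. ennreal (t i)) (- \<kappa>)"
    using assms by (auto simp: asymp_pow_def)
  have t_pos: "0 < t i" for i
    using succsim_pow_antimono_pos[OF asymp(2)] assms(7) by (simp add: mercer_system_def)
  interpret mercer_rkhs \<pi> K fn t \<psi>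
    by unfold_locales (use assms t_pos in auto)
  have d: "0 < d n" for n by (simp add: d_def)
  have "\<exists>\<phi>. \<forall>i. square_integrable \<pi> (\<phi> i) \<and> integrable \<pi> (\<phi> i) \<and> norm (adj (\<psi> i) - adj (\<phi> i)) \<le> d n" for n
    using adj_approx_integrable[OF assms(3) d] by (intro choice allI)
  then obtain \<phi> where \<phi>: "\<And>n i. square_integrable \<pi> (\<phi> n i)" "\<And>n i. integrable \<pi> (\<phi> n i)"
    "\<And>n i. norm (adj (\<psi> i) - adj (\<phi> n i)) \<le> d n"
    by metis
  define T where "T n = series_estimator \<pi> \<psi> (\<phi> n) (cutoff \<gamma> n) n" for n
  have moment: "(\<integral>\<^sup>+x. ennreal ((\<psi> i x)\<^sup>2) \<partial>\<nu>) \<le> ennreal C'" if "\<nu> \<in> G" for \<nu> i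
  proof -
    have "(\<integral>\<^sup>+x. ennreal ((\<psi> i x)\<^sup>2) \<partial>\<nu>) \<le> (SUP \<nu>\<in>G. SUP i. \<integral>\<^sup>+x. ennreal ((\<psi> i x)\<^sup>2) \<partial>\<nu>)"
      using that by (intro SUP_upper2[of \<nu>] SUP_upper) auto
    also have "\<dots> \<le> ennreal C'" using assms(12) by (simp add: C'_def ennreal_max_0')
    finally show ?thesis .
  qed
  have "precsim_pow (\<lambda>n. SUP \<nu>\<in>G. expected_loss \<pi> F n (T n) \<nu>) s"
  proof (rule precsim_powI)
    fix e :: real assume "0 < e"
    have decay: "\<forall>\<^sub>F i in sequentially. t i \<le> real i powr (- \<kappa> + \<delta>)" if "0 < \<delta>" for \<delta>
      by (rule precsim_powD[OF asymp(1) t_pos that])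
    have bias_rate: "\<forall>\<^sub>F n in sequentially. t (cutoff \<gamma> n) powr ((l + 1) / 2) \<le> real n powr (s + e)"
      unfolding \<gamma>_def s_def
      by (rule variance_bias_rate(1)[OF \<open>\<kappa> > 0\<close> \<open>l > 0\<close> t_pos _ \<open>0 < e\<close>]) (rule decay)
    have "\<exists>D>0. \<forall>\<^sub>F n in sequentially. (\<Sum>j<cutoff \<gamma> n. t j) / real n \<le> D * real n powr (2 * (s + e))"
      unfolding \<gamma>_def s_def
      by (rule variance_bias_rate(2)[OF \<open>\<kappa> > 0\<close> \<open>l > 0\<close> t_pos _ \<open>0 < e\<close>]) (rule decay)
    then obtain D where D: "D > 0"
      "\<forall>\<^sub>F n in sequentially. (\<Sum>j<cutoff \<gamma> n. t j) / real n \<le> D * real n powr (2 * (s + e))"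
      by blast
    have "\<forall>\<^sub>F n in sequentially. (SUP \<nu>\<in>G. expected_loss \<pi> F n (T n) \<nu>)
        \<le> ennreal ((1 + C' * D + r + (2 + 2 * C')) * real n powr (s + e))"
      using bias_rate D(2) eventually_ge_at_top[of 1]
    proof eventually_elim
      case (elim n)
      define a where "a = real n powr (s + e)"
      have a: "0 < a" using elim(3) by (simp add: a_def)
      have a2: "real n powr (2 * (s + e)) = a * a"
        by (simp add: a_def flip: powr_add)
      have n: "0 < n" using elim(3) by simp
      have "1 / real n \<le> a"
      proof -
        have "1 / real n = real n powr (- 1)" using n by (simp add: powr_minus_divide)
        also have "\<dots> \<le> a" unfolding a_def using n \<open>0 < e\<close> by (intro powr_mono) (auto simp: s_def)
        finally show ?thesis .
      qed
      moreover have "d n * real (cutoff \<gamma> n) \<le> 1 / real n"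
      proof -
        have "d n * real (cutoff \<gamma> n) = real (cutoff \<gamma> n) / real (cutoff \<gamma> n + 1) * (1 / real (n + 1))"
          by (simp add: d_def)
        also have "\<dots> \<le> 1 * (1 / real n)"
          using n by (intro mult_mono) (auto intro: frac_le)
        finally show ?thesis by simp
      qed
      ultimately have trunc: "d n * real (cutoff \<gamma> n) \<le> a" by linarith
      have "C' * ((\<Sum>j<cutoff \<gamma> n. t j) / real n) \<le> C' * (D * (a * a))"
        using elim(2) unfolding a2 by (intro mult_left_mono) (auto simp: C'_def)
      then have "C' * (\<Sum>j<cutoff \<gamma> n. t j) / real n / a \<le> C' * (D * (a * a)) / a"
        using a by (intro divide_right_mono) auto
      then have var: "C' * (\<Sum>j<cutoff \<gamma> n. t j) / real n / a \<le> C' * D * a" using a by simp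
      have bias: "t (cutoff \<gamma> n) powr ((l + 1) / 2) * r \<le> a * r"
        using elim(1) \<open>r > 0\<close> unfolding a_def by (intro mult_right_mono) auto
      have C'2: "0 \<le> 2 + 2 * C'" by (simp add: C'_def)
      show ?case
      proof (rule SUP_least)
        fix \<nu> assume \<nu>: "\<nu> \<in> G"
        have "expected_loss \<pi> F n (T n) \<nu> \<le> ennreal (a + C' * (\<Sum>j<cutoff \<gamma> n. t j) / real n / a
            + t (cutoff \<gamma> n) powr ((l + 1) / 2) * r + d n * real (cutoff \<gamma> n) * (2 + 2 * C'))"
          unfolding F_def T_def
          by (rule expected_loss_series_estimator[where l = l])
             (use assms(3,10,11) \<nu> n a d moment \<phi> less_imp_le[OF d] in \<open>auto simp: G_def C'_def\<close>)
        also have "\<dots> \<le> ennreal (a + C' * D * a + a * r + a * (2 + 2 * C'))"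
          by (intro ennreal_leI add_mono order_refl var bias mult_right_mono trunc C'2)
        also have "\<dots> = ennreal ((1 + C' * D + r + (2 + 2 * C')) * a)"
          by (simp add: algebra_simps)
        finally show "expected_loss \<pi> F n (T n) \<nu>
          \<le> ennreal ((1 + C' * D + r + (2 + 2 * C')) * real n powr (s + e))" by (simp add: a_def)
      qed
    qed
    then show "\<exists>D. \<forall>\<^sub>F n in sequentially. (SUP \<nu>\<in>G. expected_loss \<pi> F n (T n) \<nu>) \<le> ennreal (D * real n powr (s + e))"
      by blast
  qed
  moreover have "signed_estimator \<pi> n (T n)" for n
    unfolding T_def by (intro signed_estimator_series_estimator \<phi> square_integrable_measurable square_integrable_\<psi>)
  moreover have "(\<lambda>x. ipm \<pi> F (measure \<nu>) (T n x)) \<in> borel_measurable (Pi\<^sub>M {..<n} (\<lambda>_. \<nu>))" if "\<nu> \<in> G" for n \<nu>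
    using that unfolding F_def G_def T_def
    by (intro ipm_series_estimator_measurable assms(3) \<phi>)
  ultimately show ?thesis unfolding s_def by blast
qed

end
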